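(* Let $(U,g)$ be a metric structure and let $h$ be a gauge metric field for $g$, i.e. a non-singular smooth $(1,1)$-extensor field with $g=h^{\dagger}\circ\eta\circ h$, $\eta$ an orthogonal metric field with the same signature as $g$. Then the gauge covariant divergence and curl satisfy, for all $X\in\mathcal{M}(U)$, $$\mathbf{D}^{-}\lrcorner_{\eta}X=\frac{1}{\det[h]}\,\underline{\eta\circ h}\bigl(\partial_o\lrcorner(\det[h]\,\underline{h^{-1}\circ\eta}(X))\bigr),\qquad \mathbf{D}^{-}\wedge X=\underline{h}^{*}(\partial_o\wedge\underline{h}^{\dagger}(X)).$$
   Context: $M$ is an $n$-dimensional smooth manifold, $(U_o,\phi_o)$ a chart with coordinates $x^1,\dots,x^n$, and $U\subset U_o$ open. The canonical space $\mathcal{U}_o$ is an $n$-dimensional real vector space with basis $b_1,\dots,b_n$ and the Euclidean scalar product $b_\mu\cdot b_\nu=\delta_{\mu\nu}$, extended to $\bigwedge\mathcal{U}_o$ by determinants. $\mathcal{V}(U),\mathcal{M}(U)$ denote smooth maps from $U$ to $\mathcal{U}_o,\bigwedge\mathcal{U}_o$. For $a\in\mathcal{U}_o$, $a\cdot\partial_o X=\sum_\mu(a\cdot b_\mu)\,\partial X/\partial x^\mu$; for an endomorphism field $g$, $(a\cdot\partial_og)(b)=a\cdot\partial_o(g(b))-g(a\cdot\partial_ob)$. $v\lrcorner X$ is the Euclidean interior product by a vector $v$. $\partial_o\lrcorner X=\sum_\mu b_\mu\lrcorner\partial X/\partial x^\mu$, $\partial_o\wedge X=\sum_\mu b_\mu\wedge\partial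 X/\partial x^\mu$. ${}^\dagger$ is the Euclidean adjoint, $t^*=(t^{-1})^\dagger$, $\underline t$ the exterior-algebra extension of $t$. Metric field: smooth field $g$ of endomorphisms with $g=g^\dagger$, $\det[g]\neq0$; orthogonal metric field: metric field $\eta$ with $\eta=\eta^\dagger=\eta^{-1}$. For a metric $m$ and vector $v$: $v\lrcorner_mX=m(v)\lrcorner X$. Levi-Civita connection field: $\lambda_a(b)=\frac12g^{-1}\circ(a\cdot\partial_og)(b)+\omega_0(a)\times_gb$ with $\omega_0(a)=-\frac14\sum_{\mu,\nu}a\cdot((b_\mu\cdot\partial_og)(b_\nu)-(b_\nu\cdot\partial_og)(b_\mu))\,g^{-1}(b_\mu)\wedge g^{-1}(b_\nu)$ and $B\times_gb=-g(b)\lrcorner B$; $\Lambda_a(X)=\sum_\mu\lambda_a(b_\mu)\wedge(b_\mu\lrcorner X)$; $D_a^{-}X=a\cdot\partial_oX-\Lambda_a^{\dagger}(X)$. Gauge (deformed) covariant derivative: $\mathbf{D}_{h^{*}a}^{-}X=\underline{h}^{*}(D_a^{-}\underline{h}^{\dagger}(X))$ (the symbol $\mathbf{D}_{h^*a}^-$ is defined by this formula). Gauge divergence and curl: $\mathbf{D}^{-}\lrcorner_\eta X=\sum_\mu h^{*}(b_\mu)\lrcorner_\eta(\mathbf{D}_{h^{*}b_\mu}^{-}X)$, $\mathbf{D}^{-}\wedge X=\sum_\mu h^{*}(b_\mu)\wedge(\mathbf{D}_{h^{*}b_\mu}^{-}X)$. *)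

theory Defs
  imports "HOL-Analysis.Analysis"
begin

section \<open>Smooth maps\<close>

text \<open>For open \<open>S\<close> in a finite-dimensional space this is \<open>C\<^sup>k\<close>: all iterated directional derivatives
  of order up to \<open>k\<close> exist, the maps of order below \<open>k\<close> being differentiable, and those of order
  \<open>k\<close> are continuous.\<close>

primrec Ck_on :: "nat \<Rightarrow> 'a set \<Rightarrow> ('a::real_normed_vector \<Rightarrow> 'b::real_normed_vector) \<Rightarrow> bool" where
  "Ck_on 0 S f = continuous_on S f"
| "Ck_on (Suc k) S f =
     ((\<forall>x\<in>S. f differentiable (at x)) \<and>
      (\<forall>v. Ck_on k S (\<lambda>x. frechet_derivative f (at x) v)))"

definition smooth_on :: "'a set \<Rightarrow> ('a::real_normed_vector \<Rightarrow> 'b::real_normed_vector) \<Rightarrow> bool" where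
  "smooth_on S f \<longleftrightarrow> (\<forall>k. Ck_on k S f)"

text \<open>The manifold is a Hausdorff, second countable type \<open>'m\<close> with a smooth atlas; a chart
  consists of its domain and its coordinate map, whose values outside the domain play no role.\<close>

type_synonym ('m, 'n) chart = "'m set \<times> ('m \<Rightarrow> real ^ 'n)"

definition chart_inv :: "('m, 'n) chart \<Rightarrow> real ^ 'n \<Rightarrow> 'm" where
  "chart_inv C = inv_into (fst C) (snd C)"

definition smooth_atlas ::
    "('m::{t2_space,second_countable_topology}, 'n::finite) chart set \<Rightarrow> bool" where
  "smooth_atlas \<A> \<longleftrightarrow>
     (\<forall>C\<in>\<A>. open (fst C) \<and> open (snd C ` fst C) \<and>
        homeomorphism (fst C) (snd C ` fst C) (snd C) (chart_inv C)) \<and>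
     (\<Union>C\<in>\<A>. fst C) = UNIV \<and>
     (\<forall>C\<in>\<A>. \<forall>C'\<in>\<A>. smooth_on (snd C ` (fst C \<inter> fst C')) (snd C' \<circ> chart_inv C))"

definition smooth_map_on ::
    "('m, 'n::finite) chart set \<Rightarrow> 'm set \<Rightarrow> ('m \<Rightarrow> 'b::real_normed_vector) \<Rightarrow> bool" where
  "smooth_map_on \<A> U f \<longleftrightarrow>
     (\<forall>C\<in>\<A>. smooth_on (snd C ` (U \<inter> fst C)) (f \<circ> chart_inv C))"


section \<open>The canonical space and its exterior algebra\<close>

text \<open>The canonical space has dimension \<open>CARD('n)\<close> and its basis is indexed by \<open>'n\<close>.\<close>

type_synonym 'n canonical_space = "(real, 'n) vec"

definition bvec :: "'n::finite \<Rightarrow> 'n canonical_space" where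
  "bvec \<mu> = axis \<mu> 1"

text \<open>The exterior algebra is represented by the coefficients of multivectors on the basis blades
  \<open>b\<^sub>S = b\<^sub>i \<and> \<dots> \<and> b\<^sub>j\<close> with \<open>S = {i < \<dots> < j}\<close>. The Gram determinants of these blades are
  \<open>b\<^sub>S \<cdot> b\<^sub>T = \<delta>\<^sub>S\<^sub>T\<close>, so the determinant extension of the scalar product is the inner product of
  \<open>real ^ 'n set\<close>.\<close>

type_synonym 'n multivector = "real ^ ('n set)"

definition blade :: "'n::{finite,linorder} set \<Rightarrow> 'n multivector" where
  "blade S = axis S 1"

definition mv_of_vec :: "'n::{finite,linorder} canonical_space \<Rightarrow> 'n multivector" where
  "mv_of_vec v = (\<Sum>i\<in>UNIV. (v $ i) *\<^sub>R blade {i})"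

definition vec_of_mv :: "'n::{finite,linorder} multivector \<Rightarrow> 'n canonical_space" where
  "vec_of_mv X = (\<chi> i. X $ {i})"

text \<open>For disjoint \<open>S\<close> and \<open>T\<close>, \<open>b\<^sub>S \<and> b\<^sub>T\<close> is \<open>b\<close> of the union up to the sign of the permutation
  that sorts the indices of \<open>S\<close> followed by those of \<open>T\<close>.\<close>

definition shuffle_sign :: "'n::{finite,linorder} set \<Rightarrow> 'n set \<Rightarrow> real" where
  "shuffle_sign S T = (-1) ^ card {(i, j). i \<in> S \<and> j \<in> T \<and> j < i}"

definition wedge ::
    "'n::{finite,linorder} multivector \<Rightarrow> 'n multivector \<Rightarrow> 'n multivector" (infixl "\<^bold>\<and>" 70) where
  "X \<^bold>\<and> Y = (\<chi> S. \<Sum>T\<in>Pow S. shuffle_sign T (S - T) * X $ T * Y $ (S - T))"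

text \<open>The lemmas below show that this is the exterior algebra: the product is bilinear, associative
  and squares of vectors vanish, and the \<open>2\<^sup>n\<close> blades are the ordered products of basis vectors.\<close>

lemma wedge_add_left: "(X + Y) \<^bold>\<and> Z = X \<^bold>\<and> Z + Y \<^bold>\<and> Z"
  by (simp add: wedge_def vec_eq_iff algebra_simps sum.distrib)

lemma wedge_add_right: "X \<^bold>\<and> (Y + Z) = X \<^bold>\<and> Y + X \<^bold>\<and> Z"
  by (simp add: wedge_def vec_eq_iff algebra_simps sum.distrib)

lemma wedge_scaleR_left: "(c *\<^sub>R X) \<^bold>\<and> Y = c *\<^sub>R (X \<^bold>\<and> Y)"
  by (simp add: wedge_def vec_eq_iff sum_distrib_left algebra_simps)

lemma wedge_scaleR_right: "X \<^bold>\<and> (c *\<^sub>R Y) = c *\<^sub>R (X \<^bold>\<and> Y)"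
  by (simp add: wedge_def vec_eq_iff sum_distrib_left algebra_simps)

lemma shuffle_sign_Un_left:
  assumes "S \<inter> T = {}"
  shows "shuffle_sign (S \<union> T) R = shuffle_sign S R * shuffle_sign T R"
proof -
  have "{(i, j). i \<in> S \<union> T \<and> j \<in> R \<and> j < i} =
      {(i, j). i \<in> S \<and> j \<in> R \<and> j < i} \<union> {(i, j). i \<in> T \<and> j \<in> R \<and> j < i}" by auto
  moreover have "{(i, j). i \<in> S \<and> j \<in> R \<and> j < i} \<inter> {(i, j). i \<in> T \<and> j \<in> R \<and> j < i} = {}"
    using assms by auto
  ultimately show ?thesis
    by (simp add: shuffle_sign_def card_Un_disjoint power_add)
qed

lemma shuffle_sign_Un_right:
  assumes "S \<inter> T = {}"
  shows "shuffle_sign R (S \<union> T) = shuffle_sign R S * shuffle_sign R T"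
proof -
  have "{(i, j). i \<in> R \<and> j \<in> S \<union> T \<and> j < i} =
      {(i, j). i \<in> R \<and> j \<in> S \<and> j < i} \<union> {(i, j). i \<in> R \<and> j \<in> T \<and> j < i}" by auto
  moreover have "{(i, j). i \<in> R \<and> j \<in> S \<and> j < i} \<inter> {(i, j). i \<in> R \<and> j \<in> T \<and> j < i} = {}"
    using assms by auto
  ultimately show ?thesis
    by (simp add: shuffle_sign_def card_Un_disjoint power_add)
qed

lemma wedge_assoc: "(X \<^bold>\<and> Y) \<^bold>\<and> Z = X \<^bold>\<and> (Y \<^bold>\<and> Z)"
proof (subst vec_eq_iff, rule allI)
  fix S
  let ?f = "\<lambda>R Q P. shuffle_sign R Q * shuffle_sign R P * shuffle_sign Q P * X $ R * Y $ Q * Z $ P"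
  have "((X \<^bold>\<and> Y) \<^bold>\<and> Z) $ S = (\<Sum>T\<in>Pow S. \<Sum>R\<in>Pow T. ?f R (T - R) (S - T))"
    unfolding wedge_def vec_lambda_beta sum_distrib_left sum_distrib_right
  proof (intro sum.cong refl)
    fix T R assume "T \<in> Pow S" "R \<in> Pow T"
    then have "T = R \<union> (T - R)" by auto
    then have "shuffle_sign T (S - T) = shuffle_sign R (S - T) * shuffle_sign (T - R) (S - T)"
      using shuffle_sign_Un_left[of R "T - R" "S - T"] by auto
    then show "shuffle_sign T (S - T) * (shuffle_sign R (T - R) * X $ R * Y $ (T - R)) * Z $ (S - T) =
      ?f R (T - R) (S - T)" by simp
  qed
  also have "\<dots> = (\<Sum>(T,R)\<in>(SIGMA T:Pow S. Pow T). ?f R (T - R) (S - T))"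
    by (subst sum.Sigma) auto
  also have "\<dots> = (\<Sum>(R,Q)\<in>(SIGMA R:Pow S. Pow (S - R)). ?f R Q (S - R - Q))"
    by (rule sum.reindex_bij_witness[where i="\<lambda>(R,Q). (R \<union> Q, R)" and j="\<lambda>(T,R). (R, T - R)"])
      (auto simp: Un_Diff Diff_Int_distrib2 intro!: arg_cong2[where f="(*)"] arg_cong2[where f=shuffle_sign] arg_cong[where f="($) _"])
  also have "\<dots> = (\<Sum>R\<in>Pow S. \<Sum>Q\<in>Pow (S - R). ?f R Q (S - R - Q))"
    by (subst sum.Sigma) auto
  also have "\<dots> = (X \<^bold>\<and> (Y \<^bold>\<and> Z)) $ S"
    unfolding wedge_def vec_lambda_beta sum_distrib_left sum_distrib_right
  proof (intro sum.cong refl)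
    fix R Q assume "R \<in> Pow S" "Q \<in> Pow (S - R)"
    then have "S - R = Q \<union> (S - R - Q)" by auto
    then have "shuffle_sign R (S - R) = shuffle_sign R Q * shuffle_sign R (S - R - Q)"
      using shuffle_sign_Un_right[of Q "S - R - Q" R] by auto
    then show "?f R Q (S - R - Q) =
      shuffle_sign R (S - R) * X $ R * (shuffle_sign Q (S - R - Q) * Y $ Q * Z $ (S - R - Q))" by simp
  qed
  finally show "((X \<^bold>\<and> Y) \<^bold>\<and> Z) $ S = (X \<^bold>\<and> (Y \<^bold>\<and> Z)) $ S" .
qed

lemma blade_wedge_blade:
  "blade S \<^bold>\<and> blade T = (if S \<inter> T = {} then shuffle_sign S T *\<^sub>R blade (S \<union> T) else 0)"
proof (subst vec_eq_iff, rule allI)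
  fix R
  have "(blade S \<^bold>\<and> blade T) $ R =
     (\<Sum>Q\<in>Pow R. if Q = S then shuffle_sign S (R - S) * (if R - S = T then 1 else 0) else 0)"
    unfolding wedge_def vec_lambda_beta
    by (intro sum.cong refl) (auto simp: blade_def axis_def)
  also have "\<dots> = (if S \<subseteq> R then shuffle_sign S (R - S) * (if R - S = T then 1 else 0) else 0)"
    by (simp add: sum.delta')
  also have "\<dots> = (if S \<inter> T = {} then shuffle_sign S T *\<^sub>R blade (S \<union> T) else 0) $ R"
    by (auto simp: blade_def axis_def)
  finally show "(blade S \<^bold>\<and> blade T) $ R =
    (if S \<inter> T = {} then shuffle_sign S T *\<^sub>R blade (S \<union> T) else 0) $ R" .
qed

lemma shuffle_sign_singletons: "shuffle_sign {i} {j} = (if j < i then -1 else 1)"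
proof -
  have "{(a, b). a \<in> {i} \<and> b \<in> {j} \<and> b < a} = (if j < i then {(i, j)} else {})" by auto
  then show ?thesis by (simp add: shuffle_sign_def)
qed

lemma vec_wedge_anticommute: "mv_of_vec v \<^bold>\<and> mv_of_vec w = - (mv_of_vec w \<^bold>\<and> mv_of_vec v)"
proof -
  have sum_left: "(\<Sum>i\<in>I. f i) \<^bold>\<and> Y = (\<Sum>i\<in>I. f i \<^bold>\<and> Y)" if "finite I"
    for I f and Y :: "'a multivector"
    using that by induction (simp_all add: wedge_add_left, simp add: wedge_def vec_eq_iff)
  have sum_right: "Y \<^bold>\<and> (\<Sum>i\<in>I. f i) = (\<Sum>i\<in>I. Y \<^bold>\<and> f i)" if "finite I"
    for I f and Y :: "'a multivector"
    using that by induction (simp_all add: wedge_add_right, simp add: wedge_def vec_eq_iff)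
  have bl: "blade {i} \<^bold>\<and> blade {j} = - (blade {j} \<^bold>\<and> blade {i})" for i j :: 'a
    by (auto simp: blade_wedge_blade shuffle_sign_singletons insert_commute)
  have e: "mv_of_vec v \<^bold>\<and> mv_of_vec w =
     (\<Sum>i\<in>UNIV. \<Sum>j\<in>UNIV. (v $ i * w $ j) *\<^sub>R (blade {i} \<^bold>\<and> blade {j}))" for v w :: "'a canonical_space"
    unfolding mv_of_vec_def
    by (subst sum_left) (simp_all add: sum_right wedge_scaleR_left wedge_scaleR_right scaleR_sum_right)
  have "mv_of_vec v \<^bold>\<and> mv_of_vec w =
      (\<Sum>j\<in>UNIV. \<Sum>i\<in>UNIV. (v $ i * w $ j) *\<^sub>R (blade {i} \<^bold>\<and> blade {j}))"
    unfolding e by (rule sum.swap)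
  also have "\<dots> = (\<Sum>j\<in>UNIV. \<Sum>i\<in>UNIV. - ((w $ j * v $ i) *\<^sub>R (blade {j} \<^bold>\<and> blade {i})))"
  proof (intro sum.cong refl)
    fix i j
    show "(v $ i * w $ j) *\<^sub>R (blade {i} \<^bold>\<and> blade {j}) = - ((w $ j * v $ i) *\<^sub>R (blade {j} \<^bold>\<and> blade {i}))"
      using bl[of i j] by (simp add: mult.commute)
  qed
  also have "\<dots> = - (mv_of_vec w \<^bold>\<and> mv_of_vec v)"
    unfolding e by (simp add: sum_negf)
  finally show ?thesis .
qed

lemma vec_wedge_self: "mv_of_vec v \<^bold>\<and> mv_of_vec v = 0"
  using vec_wedge_anticommute[of v v] by (simp add: vec_eq_iff)

lemma mv_of_vec_bvec: "mv_of_vec (bvec i) = blade {i}"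
proof -
  have "mv_of_vec (bvec i) = (\<Sum>j\<in>UNIV. if j = i then blade {i} else 0)"
    unfolding mv_of_vec_def bvec_def by (intro sum.cong) (auto simp: axis_def)
  then show ?thesis by simp
qed

lemma blade_sorted_list:
  "foldr (\<lambda>i Y. mv_of_vec (bvec i) \<^bold>\<and> Y) (sorted_list_of_set S) (blade {}) = blade S"
proof -
  have "foldr (\<lambda>i Y. mv_of_vec (bvec i) \<^bold>\<and> Y) xs (blade {}) = blade (set xs)"
    if "sorted xs" "distinct xs" for xs :: "'a list"
    using that
  proof (induction xs)
    case (Cons x xs)
    have "{(a, b). a \<in> {x} \<and> b \<in> set xs \<and> b < a} = {}" using Cons.prems by auto
    then have "shuffle_sign {x} (set xs) = 1" by (simp only: shuffle_sign_def) simp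
    with Cons show ?case by (simp add: mv_of_vec_bvec blade_wedge_blade)
  qed simp
  from this[of "sorted_list_of_set S"] show ?thesis by simp
qed

text \<open>Euclidean interior product by a vector: \<open>(v \<lrcorner> X) \<cdot> Y = X \<cdot> (v \<and> Y)\<close>.\<close>

definition interior_prod ::
    "'n::{finite,linorder} canonical_space \<Rightarrow> 'n multivector \<Rightarrow> 'n multivector" where
  "interior_prod v X = adjoint (\<lambda>Y. mv_of_vec v \<^bold>\<and> Y) X"

lemma inner_interior_prod: "interior_prod v X \<bullet> Y = X \<bullet> (mv_of_vec v \<^bold>\<and> Y)"
proof -
  have "linear (\<lambda>Y. mv_of_vec v \<^bold>\<and> Y)"
    by (rule linearI) (simp_all add: wedge_add_right wedge_scaleR_right)
  from adjoint_works[OF this, of Y X] show ?thesis by (simp add: interior_prod_def inner_commute)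
qed

definition ext_map ::
    "('n::{finite,linorder} canonical_space \<Rightarrow> 'n canonical_space) \<Rightarrow> 'n multivector \<Rightarrow> 'n multivector" where
  "ext_map t X = (\<Sum>S\<in>UNIV. (X $ S) *\<^sub>R
     foldr (\<lambda>i Y. mv_of_vec (t (bvec i)) \<^bold>\<and> Y) (sorted_list_of_set S) (blade {}))"

lemma ext_map_id: "ext_map id X = X"
  by (simp add: ext_map_def blade_sorted_list) (simp add: blade_def vec_eq_iff axis_def if_distrib[of "\<lambda>x. _ * x"] cong: if_cong)

definition star_map :: "('n::finite canonical_space \<Rightarrow> 'n canonical_space) \<Rightarrow> 'n canonical_space \<Rightarrow> 'n canonical_space" where
  "star_map t = adjoint (inv t)"

definition endo_det :: "('n::finite canonical_space \<Rightarrow> 'n canonical_space) \<Rightarrow> real" where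
  "endo_det t = det (matrix t)"


section \<open>Derivatives with respect to the chart\<close>

definition partial_deriv ::
    "('m, 'n::finite) chart \<Rightarrow> 'n \<Rightarrow> ('m \<Rightarrow> 'b::real_normed_vector) \<Rightarrow> 'm \<Rightarrow> 'b" where
  "partial_deriv C \<mu> X p =
     vector_derivative (\<lambda>t. X (chart_inv C (snd C p + t *\<^sub>R bvec \<mu>))) (at 0)"

definition dir_deriv ::
    "('m, 'n::finite) chart \<Rightarrow> 'n canonical_space \<Rightarrow> ('m \<Rightarrow> 'b::real_normed_vector) \<Rightarrow> 'm \<Rightarrow> 'b" where
  "dir_deriv C a X p = (\<Sum>\<mu>\<in>UNIV. (a \<bullet> bvec \<mu>) *\<^sub>R partial_deriv C \<mu> X p)"

type_synonym ('m, 'n) endo_field = "'m \<Rightarrow> 'n canonical_space \<Rightarrow> 'n canonical_space"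

text \<open>\<open>(a \<cdot> \<partial>\<^sub>o g)(b)\<close> for a vector field \<open>b\<close>.\<close>

definition dir_deriv_endo ::
    "('m, 'n::finite) chart \<Rightarrow> 'n canonical_space \<Rightarrow> ('m, 'n) endo_field \<Rightarrow> ('m \<Rightarrow> 'n canonical_space) \<Rightarrow> 'm \<Rightarrow> 'n canonical_space" where
  "dir_deriv_endo C a g b p = dir_deriv C a (\<lambda>q. g q (b q)) p - g p (dir_deriv C a b p)"

definition chart_div ::
    "('m, 'n::{finite,linorder}) chart \<Rightarrow> ('m \<Rightarrow> 'n multivector) \<Rightarrow> 'm \<Rightarrow> 'n multivector" where
  "chart_div C X p = (\<Sum>\<mu>\<in>UNIV. interior_prod (bvec \<mu>) (partial_deriv C \<mu> X p))"

definition chart_curl ::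
    "('m, 'n::{finite,linorder}) chart \<Rightarrow> ('m \<Rightarrow> 'n multivector) \<Rightarrow> 'm \<Rightarrow> 'n multivector" where
  "chart_curl C X p = (\<Sum>\<mu>\<in>UNIV. mv_of_vec (bvec \<mu>) \<^bold>\<and> partial_deriv C \<mu> X p)"


section \<open>Metric fields\<close>

definition smooth_endo_field ::
    "('m, 'n::finite) chart set \<Rightarrow> 'm set \<Rightarrow> ('m, 'n) endo_field \<Rightarrow> bool" where
  "smooth_endo_field \<A> U t \<longleftrightarrow>
     (\<forall>p\<in>U. linear (t p)) \<and> smooth_map_on \<A> U (\<lambda>p. matrix (t p))"

definition metric_field ::
    "('m, 'n::finite) chart set \<Rightarrow> 'm set \<Rightarrow> ('m, 'n) endo_field \<Rightarrow> bool" where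
  "metric_field \<A> U g \<longleftrightarrow> smooth_endo_field \<A> U g \<and>
     (\<forall>p\<in>U. g p = adjoint (g p) \<and> endo_det (g p) \<noteq> 0)"

definition orthogonal_metric_field ::
    "('m, 'n::finite) chart set \<Rightarrow> 'm set \<Rightarrow> ('m, 'n) endo_field \<Rightarrow> bool" where
  "orthogonal_metric_field \<A> U \<eta> \<longleftrightarrow> metric_field \<A> U \<eta> \<and> (\<forall>p\<in>U. \<eta> p = inv (\<eta> p))"

text \<open>The numbers of positive and of negative eigenvalues of a symmetric endomorphism, counted
  with multiplicity.\<close>

definition metric_signature :: "('n::finite canonical_space \<Rightarrow> 'n canonical_space) \<Rightarrow> nat \<times> nat" where
  "metric_signature t =
     (\<Sum>l | l > 0 \<and> (\<exists>v. v \<noteq> 0 \<and> t v = l *\<^sub>R v). dim {v. t v = l *\<^sub>R v},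
      \<Sum>l | l < 0 \<and> (\<exists>v. v \<noteq> 0 \<and> t v = l *\<^sub>R v). dim {v. t v = l *\<^sub>R v})"

definition gauge_metric_field ::
    "('m, 'n::finite) chart set \<Rightarrow> 'm set \<Rightarrow> ('m, 'n) endo_field \<Rightarrow> ('m, 'n) endo_field \<Rightarrow>
     ('m, 'n) endo_field \<Rightarrow> bool" where
  "gauge_metric_field \<A> U g \<eta> h \<longleftrightarrow>
     smooth_endo_field \<A> U h \<and> (\<forall>p\<in>U. endo_det (h p) \<noteq> 0) \<and>
     orthogonal_metric_field \<A> U \<eta> \<and>
     (\<forall>p\<in>U. metric_signature (\<eta> p) = metric_signature (g p)) \<and>
     (\<forall>p\<in>U. g p = adjoint (h p) \<circ> \<eta> p \<circ> h p)"

definition metric_interior_prod ::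
    "('n::{finite,linorder} canonical_space \<Rightarrow> 'n canonical_space) \<Rightarrow> 'n canonical_space \<Rightarrow> 'n multivector \<Rightarrow> 'n multivector" where
  "metric_interior_prod m v X = interior_prod (m v) X"


section \<open>Levi-Civita and gauge covariant derivatives\<close>

definition omega0 ::
    "('m, 'n::{finite,linorder}) chart \<Rightarrow> ('m, 'n) endo_field \<Rightarrow> 'n canonical_space \<Rightarrow> 'm \<Rightarrow> 'n multivector" where
  "omega0 C g a p = - (1/4) *\<^sub>R (\<Sum>\<mu>\<in>UNIV. \<Sum>\<nu>\<in>UNIV.
     (a \<bullet> (dir_deriv_endo C (bvec \<mu>) g (\<lambda>_. bvec \<nu>) p
          - dir_deriv_endo C (bvec \<nu>) g (\<lambda>_. bvec \<mu>) p)) *\<^sub>R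
     (mv_of_vec (inv (g p) (bvec \<mu>)) \<^bold>\<and> mv_of_vec (inv (g p) (bvec \<nu>))))"

text \<open>\<open>B \<times>\<^sub>m b\<close> for a bivector \<open>B\<close>. Only grade 1 of the multivector on the right-hand side is
  nonzero, so that \<open>vec_of_mv\<close> discards nothing.\<close>

definition metric_commutator ::
    "('n::{finite,linorder} canonical_space \<Rightarrow> 'n canonical_space) \<Rightarrow> 'n multivector \<Rightarrow> 'n canonical_space \<Rightarrow> 'n canonical_space" where
  "metric_commutator m B b = vec_of_mv (- interior_prod (m b) B)"

definition levi_civita ::
    "('m, 'n::{finite,linorder}) chart \<Rightarrow> ('m, 'n) endo_field \<Rightarrow> 'n canonical_space \<Rightarrow> ('m, 'n) endo_field" where
  "levi_civita C g a p b =
     (1/2) *\<^sub>R inv (g p) (dir_deriv_endo C a g (\<lambda>_. b) p)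
     + metric_commutator (g p) (omega0 C g a p) b"

definition levi_civita_ext ::
    "('m, 'n::{finite,linorder}) chart \<Rightarrow> ('m, 'n) endo_field \<Rightarrow> 'n canonical_space \<Rightarrow>
     'm \<Rightarrow> 'n multivector \<Rightarrow> 'n multivector" where
  "levi_civita_ext C g a p X =
     (\<Sum>\<mu>\<in>UNIV. mv_of_vec (levi_civita C g a p (bvec \<mu>)) \<^bold>\<and> interior_prod (bvec \<mu>) X)"

definition cov_deriv_minus ::
    "('m, 'n::{finite,linorder}) chart \<Rightarrow> ('m, 'n) endo_field \<Rightarrow> 'n canonical_space \<Rightarrow>
     ('m \<Rightarrow> 'n multivector) \<Rightarrow> 'm \<Rightarrow> 'n multivector" where
  "cov_deriv_minus C g a X p =
     dir_deriv C a X p - adjoint (levi_civita_ext C g a p) (X p)"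

text \<open>The gauge derivative in the direction \<open>h\<^sup>* a\<close>, as a function of \<open>a\<close>.\<close>

definition gauge_cov_deriv_minus ::
    "('m, 'n::{finite,linorder}) chart \<Rightarrow> ('m, 'n) endo_field \<Rightarrow> ('m, 'n) endo_field \<Rightarrow> 'n canonical_space \<Rightarrow>
     ('m \<Rightarrow> 'n multivector) \<Rightarrow> 'm \<Rightarrow> 'n multivector" where
  "gauge_cov_deriv_minus C g h a X p =
     ext_map (star_map (h p)) (cov_deriv_minus C g a (\<lambda>q. ext_map (adjoint (h q)) (X q)) p)"

definition gauge_div ::
    "('m, 'n::{finite,linorder}) chart \<Rightarrow> ('m, 'n) endo_field \<Rightarrow> ('m, 'n) endo_field \<Rightarrow>
     ('m, 'n) endo_field \<Rightarrow> ('m \<Rightarrow> 'n multivector) \<Rightarrow> 'm \<Rightarrow> 'n multivector" where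
  "gauge_div C g \<eta> h X p =
     (\<Sum>\<mu>\<in>UNIV. metric_interior_prod (\<eta> p) (star_map (h p) (bvec \<mu>))
        (gauge_cov_deriv_minus C g h (bvec \<mu>) X p))"

definition gauge_curl ::
    "('m, 'n::{finite,linorder}) chart \<Rightarrow> ('m, 'n) endo_field \<Rightarrow> ('m, 'n) endo_field \<Rightarrow>
     ('m \<Rightarrow> 'n multivector) \<Rightarrow> 'm \<Rightarrow> 'n multivector" where
  "gauge_curl C g h X p =
     (\<Sum>\<mu>\<in>UNIV. mv_of_vec (star_map (h p) (bvec \<mu>)) \<^bold>\<and>
        gauge_cov_deriv_minus C g h (bvec \<mu>) X p)"

end

(* At each point, Lambda_a is the derivation of the exterior algebra extending lambda_a, and lambda is
   torsion-free (lambda_a(b) = lambda_b(a) on constant vectors) and compatible with g: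
   partial_mu g = lambda_mu^dagger g + g lambda_mu.

   Curl: D^- wedge Y differs from the chart curl of Y by sum b_mu wedge b_nu wedge (lambda_mu(b_nu) _| Y),
   which vanishes by symmetry of lambda.

   Divergence: with Y = h^dagger(X) and W = (h^-1 eta)(X) (extended to multivectors) one has Y = g(W), and
   the Leibniz rule for the extension of g turns compatibility into D_mu^- Y = g(partial_mu W + Lambda_mu W).
   Contracting with b_mu, torsion-freeness leaves partial _| W plus the sum of tr(lambda_nu) b_nu _| W, and
   tr(lambda_nu) = partial_nu det[h] / det[h] by Jacobi's formula, because det[g]^2 = det[h]^4. *)

theory Submission
  imports Defs
begin

section \<open>Exterior algebra\<close>

text \<open>The obstacle in the divergence is that \<open>h\<close>, its inverse and
  \<open>\<eta>\<close> all vary from point to point, while compatibility controls the derivative of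
  \<open>g\<close> alone. This is what W is for: the derivative of g(W) involves only those of
  \<open>g\<close> and W, and the derivative of W enters both sides of the claim unevaluated. Only
  its existence has to be shown, and Cramer's rule supplies that for the inverse of
  \<open>h\<close>. The even powers of the determinants remove det[\<eta>], a sign whose local
  constancy would otherwise have to be argued. Derivatives are taken along coordinate lines, where
  identities valid near the parameter 0 may be differentiated.\<close>

lemma linear_mv_of_vec: "linear mv_of_vec"
  by (rule linearI) (simp_all add: mv_of_vec_def scaleR_add_left sum.distrib scaleR_sum_right)

lemma bounded_bilinear_wedge: "bounded_bilinear (\<^bold>\<and>)"
  by (rule bilinear_conv_bounded_bilinear[THEN iffD1])
    (auto simp: bilinear_def intro!: linearI
      simp: wedge_add_left wedge_add_right wedge_scaleR_left wedge_scaleR_right)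

interpretation wedge: bounded_bilinear "(\<^bold>\<and>) :: 'n::{finite,linorder} multivector \<Rightarrow> _"
  by (rule bounded_bilinear_wedge)

lemma inner_interior_prod_right: "Y \<bullet> interior_prod v X = (mv_of_vec v \<^bold>\<and> Y) \<bullet> X"
  using inner_interior_prod[of v X Y] by (simp add: inner_commute)

lemma linear_interior_prod: "linear (interior_prod v)"
  by (rule linearI; rule vector_eq_ldot[THEN iffD1, rule_format])
    (simp_all add: inner_interior_prod_right inner_add_right)

lemma interior_prod_add_left: "interior_prod (v + w) X = interior_prod v X + interior_prod w X"
  by (rule vector_eq_ldot[THEN iffD1, rule_format])
    (simp add: inner_interior_prod_right inner_add_right inner_add_left
      linear_add[OF linear_mv_of_vec] wedge.add_left)

lemma interior_prod_scaleR_left: "interior_prod (c *\<^sub>R v) X = c *\<^sub>R interior_prod v X"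
  by (rule vector_eq_ldot[THEN iffD1, rule_format])
    (simp add: inner_interior_prod_right
      linear_scale[OF linear_mv_of_vec] wedge.scaleR_left)

lemma linear_interior_prod_left: "linear (\<lambda>v. interior_prod v X)"
  by (rule linearI) (simp_all add: interior_prod_add_left interior_prod_scaleR_left)

lemma inner_bvec: "v \<bullet> bvec i = v $ i" "bvec i \<bullet> v = v $ i"
  by (simp_all add: bvec_def inner_axis inner_commute[of "axis _ _"])

lemma bvec_nth: "bvec i $ j = (if i = j then 1 else 0)"
  by (auto simp: bvec_def axis_def)

lemma bvec_expansion: "(\<Sum>i\<in>UNIV. (v $ i) *\<^sub>R bvec i) = v"
  by (simp add: vec_eq_iff bvec_nth if_distrib cong: if_cong)

lemma linear_bvec_expansion:
  fixes f :: "'n::finite canonical_space \<Rightarrow> 'b::real_vector"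
  assumes "linear f"
  shows "f v = (\<Sum>i\<in>UNIV. (v $ i) *\<^sub>R f (bvec i))"
  by (subst bvec_expansion[of v, symmetric])
    (simp add: linear_sum[OF assms] linear_scale[OF assms])

lemma linear_ext_bvec:
  fixes f g :: "'n::finite canonical_space \<Rightarrow> 'b::real_vector"
  assumes "linear f" "linear g" "\<And>i. f (bvec i) = g (bvec i)"
  shows "f v = g v"
  by (simp add: assms(3) linear_bvec_expansion[OF assms(1), of v] linear_bvec_expansion[OF assms(2), of v])

lemma blade_expansion: "(\<Sum>S\<in>UNIV. (X $ S) *\<^sub>R blade S) = X"
  by (simp add: vec_eq_iff blade_def axis_def if_distrib cong: if_cong)

text \<open>Blades are iterated wedge products of basis vectors with the unit blade
  \<open>blade {}\<close> and span the algebra, so these closure properties reach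
  everything.\<close>

lemma multivector_induct [case_names zero add scaleR one wedge]:
  assumes "P 0" and add: "\<And>X Y. P X \<Longrightarrow> P Y \<Longrightarrow> P (X + Y)" and scale: "\<And>c X. P X \<Longrightarrow> P (c *\<^sub>R X)"
    and "P (blade {})" and wedge: "\<And>v X. P X \<Longrightarrow> P (mv_of_vec v \<^bold>\<and> X)"
  shows "P X"
proof -
  have "P (foldr (\<lambda>i Y. mv_of_vec (bvec i) \<^bold>\<and> Y) xs (blade {}))" for xs
    by (induction xs) (auto intro: assms)
  then have "P (blade S)" for S
    using blade_sorted_list[of S] by metis
  then have "P (\<Sum>S\<in>A. (X $ S) *\<^sub>R blade S)" for A
    by (induction A rule: infinite_finite_induct) (auto intro: assms)
  from this[of UNIV] show ?thesis by (simp add: blade_expansion)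
qed

text \<open>Two linear maps that obey the same recursion under left multiplication by a vector
  cannot differ.\<close>

lemma linear_ext_multivector:
  fixes f g :: "'n::{finite,linorder} multivector \<Rightarrow> 'b::real_vector"
  assumes f: "linear f" and g: "linear g" and "f (blade {}) = g (blade {})"
    and "\<And>v X. f X = g X \<Longrightarrow> f (mv_of_vec v \<^bold>\<and> X) = g (mv_of_vec v \<^bold>\<and> X)"
  shows "f X = g X"
  by (induction X rule: multivector_induct)
    (auto simp: assms(3,4) linear_0[OF f] linear_0[OF g] linear_add[OF f] linear_add[OF g]
      linear_scale[OF f] linear_scale[OF g])

section \<open>Wedge product with a vector and contraction by a vector\<close>

lemma vec_wedge_swap: "mv_of_vec u \<^bold>\<and> (mv_of_vec v \<^bold>\<and> X) = - (mv_of_vec v \<^bold>\<and> (mv_of_vec u \<^bold>\<and> X))"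
  by (simp add: wedge.minus_left vec_wedge_anticommute[of u v] flip: wedge_assoc)

lemma vec_wedge_twice: "mv_of_vec u \<^bold>\<and> (mv_of_vec u \<^bold>\<and> X) = 0"
  by (simp add: wedge.zero_left vec_wedge_self flip: wedge_assoc)

lemma bvec_wedge_nth:
  "(mv_of_vec (bvec i) \<^bold>\<and> X) $ S = (if i \<in> S then shuffle_sign {i} (S - {i}) * X $ (S - {i}) else 0)"
proof -
  have "(mv_of_vec (bvec i) \<^bold>\<and> X) $ S =
      (\<Sum>T\<in>Pow S. if T = {i} then shuffle_sign {i} (S - {i}) * X $ (S - {i}) else 0)"
    unfolding mv_of_vec_bvec wedge_def vec_lambda_beta
    by (intro sum.cong) (auto simp: blade_def axis_def)
  then show ?thesis by (simp add: sum.delta')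
qed

lemma interior_prod_bvec_nth:
  "interior_prod (bvec i) X $ S = (if i \<in> S then 0 else shuffle_sign {i} S * X $ insert i S)"
proof -
  have "interior_prod (bvec i) X $ S = interior_prod (bvec i) X \<bullet> blade S"
    by (simp add: blade_def inner_axis)
  also have "\<dots> = X \<bullet> (blade {i} \<^bold>\<and> blade S)"
    by (simp add: inner_interior_prod mv_of_vec_bvec)
  also have "\<dots> = (if i \<in> S then 0 else shuffle_sign {i} S * X $ insert i S)"
    by (simp add: blade_wedge_blade) (simp add: blade_def inner_axis)
  finally show ?thesis .
qed

lemma shuffle_sign_square: "shuffle_sign S T * shuffle_sign S T = 1"
  by (simp add: shuffle_sign_def flip: power_mult_distrib)

text \<open>The canonical anticommutation relation, and the only place where signs of wedge and
  contraction are compared coefficient by coefficient.\<close>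

lemma interior_prod_bvec_wedge_bvec:
  "interior_prod (bvec i) (mv_of_vec (bvec j) \<^bold>\<and> X) =
    (if i = j then X else 0) - mv_of_vec (bvec j) \<^bold>\<and> interior_prod (bvec i) X"
proof (subst vec_eq_iff, rule allI)
  fix S
  \<comment> \<open>For distinct indices a coefficient at \<open>S\<close> can be nonzero only if
    \<open>S\<close> contains j and not i; in the third case every term vanishes.\<close>
  consider "i = j" | "i \<noteq> j" "j \<in> S" "i \<notin> S" | "i \<noteq> j" "\<not> (j \<in> S \<and> i \<notin> S)" by auto
  then show "interior_prod (bvec i) (mv_of_vec (bvec j) \<^bold>\<and> X) $ S =
    ((if i = j then X else 0) - mv_of_vec (bvec j) \<^bold>\<and> interior_prod (bvec i) X) $ S"
  proof cases
    case 1
    have "shuffle_sign A B * (shuffle_sign A B * c) = c" for A B :: "'a set" and c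
      by (simp add: shuffle_sign_square flip: mult.assoc)
    with 1 show ?thesis
      by (cases "i \<in> S") (simp_all add: interior_prod_bvec_nth bvec_wedge_nth insert_absorb)
  next
    case 2
    \<comment> \<open>Both orders of the operations pass the same indices \<open>S - {j}\<close>.
      With these split off, the signs differ by the relative order of i and j, which supplies the
      minus.\<close>
    have i: "shuffle_sign {i} S = shuffle_sign {i} {j} * shuffle_sign {i} (S - {j})"
      using shuffle_sign_Un_right[of "{j}" "S - {j}" "{i}"] 2 by (simp add: insert_absorb)
    have j: "shuffle_sign {j} (insert i S - {j}) = shuffle_sign {j} {i} * shuffle_sign {j} (S - {j})"
      using shuffle_sign_Un_right[of "{i}" "S - {j}" "{j}"] 2 by (simp add: insert_Diff_if)
    have ji: "shuffle_sign {i} {j} = - shuffle_sign {j} {i}"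
      using 2 by (auto simp: shuffle_sign_singletons)
    have sq: "shuffle_sign {j} {i} * (shuffle_sign {j} {i} * c) = c" for c
      by (simp add: shuffle_sign_square flip: mult.assoc)
    have eq: "insert i S - {j} = insert i (S - {j})" using 2 by auto
    have "interior_prod (bvec i) (mv_of_vec (bvec j) \<^bold>\<and> X) $ S =
        shuffle_sign {i} S * (shuffle_sign {j} (insert i S - {j}) * X $ (insert i S - {j}))"
      using 2 by (simp add: interior_prod_bvec_nth bvec_wedge_nth)
    also have "\<dots> = - (shuffle_sign {j} (S - {j}) * (shuffle_sign {i} (S - {j}) * X $ insert i (S - {j})))"
      unfolding i j ji unfolding eq using sq by (simp add: mult.assoc mult.left_commute)
    also have "\<dots> = - (mv_of_vec (bvec j) \<^bold>\<and> interior_prod (bvec i) X) $ S"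
      using 2 by (simp add: interior_prod_bvec_nth bvec_wedge_nth)
    finally show ?thesis using 2 by simp
  next
    case 3
    then show ?thesis
      by (auto simp: interior_prod_bvec_nth bvec_wedge_nth)
  qed
qed

text \<open>Contraction is an antiderivation; linearity in \<open>v\<close> and in \<open>u\<close>
  leaves the relation for basis vectors.\<close>

lemma interior_prod_vec_wedge:
  "interior_prod v (mv_of_vec u \<^bold>\<and> X) = (v \<bullet> u) *\<^sub>R X - mv_of_vec u \<^bold>\<and> interior_prod v X"
proof (rule linear_ext_bvec[of "\<lambda>v. interior_prod v (mv_of_vec u \<^bold>\<and> X)"
      "\<lambda>v. (v \<bullet> u) *\<^sub>R X - mv_of_vec u \<^bold>\<and> interior_prod v X"])
  fix i
  show "interior_prod (bvec i) (mv_of_vec u \<^bold>\<and> X) =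
      (bvec i \<bullet> u) *\<^sub>R X - mv_of_vec u \<^bold>\<and> interior_prod (bvec i) X"
    by (rule linear_ext_bvec[of "\<lambda>u. interior_prod (bvec i) (mv_of_vec u \<^bold>\<and> X)"
      "\<lambda>u. (bvec i \<bullet> u) *\<^sub>R X - mv_of_vec u \<^bold>\<and> interior_prod (bvec i) X"])
      (auto intro!: linearI simp: linear_add[OF linear_mv_of_vec] linear_scale[OF linear_mv_of_vec]
        wedge.add_left wedge.scaleR_left linear_add[OF linear_interior_prod]
        linear_scale[OF linear_interior_prod] inner_add_right algebra_simps
        interior_prod_bvec_wedge_bvec inner_bvec bvec_nth)
qed (auto intro!: linearI simp: interior_prod_add_left interior_prod_scaleR_left inner_add_left
    wedge.add_right wedge.scaleR_right algebra_simps)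

lemma interior_prod_one: "interior_prod v (blade {}) = 0"
proof -
  have "interior_prod (bvec i) (blade {}) = 0" for i :: 'a
    by (simp add: vec_eq_iff interior_prod_bvec_nth) (simp add: blade_def axis_def)
  then show ?thesis
    by (subst linear_bvec_expansion[OF linear_interior_prod_left]) simp
qed

text \<open>Adjoint form of the sign rule for two vector factors.\<close>

lemma interior_prod_anticommute:
  "interior_prod v (interior_prod w X) = - interior_prod w (interior_prod v X)"
proof (rule vector_eq_ldot[THEN iffD1, rule_format])
  fix Y
  have "interior_prod v (interior_prod w X) \<bullet> Y = - (interior_prod w (interior_prod v X) \<bullet> Y)"
    by (simp add: inner_interior_prod vec_wedge_swap[of w v])
  then show "Y \<bullet> interior_prod v (interior_prod w X) = Y \<bullet> - interior_prod w (interior_prod v X)"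
    by (simp add: inner_commute)
qed

section \<open>Extension of endomorphisms to the exterior algebra\<close>

lemma linear_ext_map: "linear (ext_map t)"
  by (rule linearI) (simp_all add: ext_map_def scaleR_add_left sum.distrib scaleR_sum_right)

lemma ext_map_blade:
  "ext_map t (blade S) = foldr (\<lambda>i Y. mv_of_vec (t (bvec i)) \<^bold>\<and> Y) (sorted_list_of_set S) (blade {})"
proof -
  have "ext_map t (blade S) = (\<Sum>T\<in>UNIV. if T = S then
      foldr (\<lambda>i Y. mv_of_vec (t (bvec i)) \<^bold>\<and> Y) (sorted_list_of_set S) (blade {}) else 0)"
    unfolding ext_map_def by (intro sum.cong) (auto simp: blade_def axis_def)
  then show ?thesis by simp
qed

lemma ext_map_one: "ext_map t (blade {}) = blade {}"
  by (simp add: ext_map_blade)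

lemma ext_map_bvec_wedge_blade_less:
  assumes "\<And>j. j \<in> S \<Longrightarrow> i < j"
  shows "ext_map t (mv_of_vec (bvec i) \<^bold>\<and> blade S) = mv_of_vec (t (bvec i)) \<^bold>\<and> ext_map t (blade S)"
proof -
  have "i \<notin> S" using assms by blast
  have "{(a, b). a \<in> {i} \<and> b \<in> S \<and> b < a} = {}" by (auto dest: assms)
  then have "shuffle_sign {i} S = 1" by (simp only: shuffle_sign_def) simp
  then have "mv_of_vec (bvec i) \<^bold>\<and> blade S = blade (insert i S)"
    using \<open>i \<notin> S\<close> by (simp add: mv_of_vec_bvec blade_wedge_blade)
  moreover have "sorted_list_of_set (insert i S) = i # sorted_list_of_set S"
    using \<open>i \<notin> S\<close> by (simp add: insort_is_Cons assms less_imp_le)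
  ultimately show ?thesis by (simp add: ext_map_blade)
qed

text \<open>Since \<open>ext_map\<close> is defined on sorted blades, multiplicativity is a matter
  of sorting a new factor into place. The induction adds ever smaller indices to \<open>S\<close>:
  the new factor comes first, or is repeated, or is exchanged with the least factor at the cost of
  the same sign on both sides.\<close>

lemma ext_map_bvec_wedge_blade:
  "ext_map t (mv_of_vec (bvec i) \<^bold>\<and> blade S) = mv_of_vec (t (bvec i)) \<^bold>\<and> ext_map t (blade S)"
proof (induction S rule: finite_linorder_min_induct[OF finite])
  case 1
  then show ?case by (rule ext_map_bvec_wedge_blade_less) simp
next
  case (2 x S)
  let ?b = "\<lambda>i. mv_of_vec (bvec i)" and ?t = "\<lambda>i. mv_of_vec (t (bvec i))"
  have [simp]: "x \<notin> S" using 2(2) by blast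
  have low: "ext_map t (?b x \<^bold>\<and> blade T) = ?t x \<^bold>\<and> ext_map t (blade T)" if "T \<subseteq> insert i S" "x < i" for T
    using that 2(2) by (intro ext_map_bvec_wedge_blade_less) auto
  have sign: "shuffle_sign {x} S *\<^sub>R shuffle_sign {x} S *\<^sub>R Y = Y" for Y :: "'a multivector"
    by (simp add: shuffle_sign_square)
  have "?b x \<^bold>\<and> blade S = shuffle_sign {x} S *\<^sub>R blade (insert x S)"
    by (simp add: mv_of_vec_bvec blade_wedge_blade)
  then have xS: "blade (insert x S) = shuffle_sign {x} S *\<^sub>R (?b x \<^bold>\<and> blade S)"
    by (simp only: sign)
  have "ext_map t (?b x \<^bold>\<and> blade S) = ?t x \<^bold>\<and> ext_map t (blade S)"
    using 2(2) by (intro ext_map_bvec_wedge_blade_less) auto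
  then have txS: "ext_map t (blade (insert x S)) = shuffle_sign {x} S *\<^sub>R (?t x \<^bold>\<and> ext_map t (blade S))"
    by (simp add: xS linear_scale[OF linear_ext_map])
  consider "i < x" | "i = x" | "x < i" by force
  then show ?case
  proof cases
    case 1
    with 2(2) show ?thesis by (intro ext_map_bvec_wedge_blade_less) auto
  next
    case i: 2
    show ?thesis
      unfolding txS unfolding xS i
      by (simp add: vec_wedge_twice linear_0[OF linear_ext_map] wedge.scaleR_right)
  next
    case 3
    have "?b i \<^bold>\<and> blade S = (if i \<in> S then 0 else shuffle_sign {i} S *\<^sub>R blade (insert i S))"
      by (simp add: mv_of_vec_bvec blade_wedge_blade)
    then have "ext_map t (?b x \<^bold>\<and> (?b i \<^bold>\<and> blade S)) = ?t x \<^bold>\<and> ext_map t (?b i \<^bold>\<and> blade S)"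
      using low[of "insert i S"] 3
      by (simp add: wedge.scaleR_right wedge.zero_right linear_scale[OF linear_ext_map] linear_0[OF linear_ext_map])
    then show ?thesis
      unfolding txS unfolding xS
      by (simp add: wedge.scaleR_right linear_scale[OF linear_ext_map] linear_neg[OF linear_ext_map]
          vec_wedge_swap[of "bvec i" "bvec x"] vec_wedge_swap[of "t (bvec i)" "t (bvec x)"] 2(3))
  qed
qed

lemma ext_map_vec_wedge:
  assumes "linear t"
  shows "ext_map t (mv_of_vec v \<^bold>\<and> X) = mv_of_vec (t v) \<^bold>\<and> ext_map t X"
proof -
  note lin = linear_add[OF assms] linear_scale[OF assms] linear_add[OF linear_ext_map] linear_scale[OF linear_ext_map]
    linear_add[OF linear_mv_of_vec] linear_scale[OF linear_mv_of_vec]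
    wedge.add_left wedge.add_right wedge.scaleR_left wedge.scaleR_right
  have basis: "ext_map t (mv_of_vec (bvec i) \<^bold>\<and> X) = mv_of_vec (t (bvec i)) \<^bold>\<and> ext_map t X" for i
    by (subst (1 2) blade_expansion[of X, symmetric])
      (simp add: wedge.sum_right wedge.scaleR_right linear_sum[OF linear_ext_map]
        linear_scale[OF linear_ext_map] ext_map_bvec_wedge_blade)
  show ?thesis
    by (rule linear_ext_bvec[of "\<lambda>v. ext_map t (mv_of_vec v \<^bold>\<and> X)"
          "\<lambda>v. mv_of_vec (t v) \<^bold>\<and> ext_map t X"])
      (auto intro!: linearI simp: lin basis)
qed

lemma ext_map_comp:
  assumes "linear s" "linear t"
  shows "ext_map (s \<circ> t) X = ext_map s (ext_map t X)"
  by (rule linear_ext_multivector[OF linear_ext_map linear_compose[OF linear_ext_map linear_ext_map,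
        unfolded comp_def], of "s \<circ> t" s t X])
    (simp_all add: ext_map_one ext_map_vec_wedge assms linear_compose)

text \<open>On one vector factor this is \<open>v \<bullet> t u = adjoint t v \<bullet> u\<close>,
  carried through by induction over wedge factors. The adjoint is what later cancels the metric in
  the gauge divergence.\<close>

lemma interior_prod_ext_map:
  assumes "linear t"
  shows "interior_prod v (ext_map t X) = ext_map t (interior_prod (adjoint t v) X)"
proof (rule linear_ext_multivector[of "\<lambda>X. interior_prod v (ext_map t X)"
      "\<lambda>X. ext_map t (interior_prod (adjoint t v) X)"])
  show "linear (\<lambda>X. interior_prod v (ext_map t X))"
    using linear_compose[OF linear_ext_map linear_interior_prod] by (simp add: comp_def)
  show "linear (\<lambda>X. ext_map t (interior_prod (adjoint t v) X))"
    using linear_compose[OF linear_interior_prod linear_ext_map] by (simp add: comp_def)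
qed (simp_all add: ext_map_one interior_prod_one linear_0[OF linear_ext_map] ext_map_vec_wedge assms
    interior_prod_vec_wedge linear_diff[OF linear_ext_map] linear_scale[OF linear_ext_map]
    adjoint_clauses)

text \<open>The pattern of \<open>levi_civita_ext\<close> for an arbitrary endomorphism; it
  separates the calculus of derivations from the connection and covers adjoints as well.\<close>

definition derivation_ext ::
    "('n::{finite,linorder} canonical_space \<Rightarrow> 'n canonical_space) \<Rightarrow> 'n multivector \<Rightarrow> 'n multivector" where
  "derivation_ext l X = (\<Sum>\<mu>\<in>UNIV. mv_of_vec (l (bvec \<mu>)) \<^bold>\<and> interior_prod (bvec \<mu>) X)"

lemma linear_derivation_ext: "linear (derivation_ext l)"
  by (rule linearI)
    (simp_all add: derivation_ext_def linear_add[OF linear_interior_prod] wedge.add_right sum.distrib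
      linear_scale[OF linear_interior_prod] wedge.scaleR_right scaleR_sum_right)

lemma derivation_ext_one: "derivation_ext l (blade {}) = 0"
  by (simp add: derivation_ext_def interior_prod_one wedge.zero_right)

text \<open>Contracting \<open>u\<close> against the basis reassembles \<open>l u\<close>; in the
  other term the signs from the contraction and from exchanging two vector factors cancel.\<close>

lemma derivation_ext_vec_wedge:
  assumes "linear l"
  shows "derivation_ext l (mv_of_vec u \<^bold>\<and> X) = mv_of_vec (l u) \<^bold>\<and> X + mv_of_vec u \<^bold>\<and> derivation_ext l X"
proof -
  have "derivation_ext l (mv_of_vec u \<^bold>\<and> X) =
      (\<Sum>\<mu>\<in>UNIV. (u $ \<mu>) *\<^sub>R (mv_of_vec (l (bvec \<mu>)) \<^bold>\<and> X)) +
      (\<Sum>\<mu>\<in>UNIV. mv_of_vec u \<^bold>\<and> (mv_of_vec (l (bvec \<mu>)) \<^bold>\<and> interior_prod (bvec \<mu>) X))"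
    by (simp add: derivation_ext_def interior_prod_vec_wedge wedge.diff_right wedge.scaleR_right
        inner_bvec vec_wedge_swap[of "l (bvec _)" u] sum.distrib)
  also have "(\<Sum>\<mu>\<in>UNIV. (u $ \<mu>) *\<^sub>R (mv_of_vec (l (bvec \<mu>)) \<^bold>\<and> X)) = mv_of_vec (l u) \<^bold>\<and> X"
    by (subst linear_bvec_expansion[OF assms, of u])
      (simp add: linear_sum[OF linear_mv_of_vec] linear_scale[OF linear_mv_of_vec]
        wedge.sum_left wedge.scaleR_left)
  finally show ?thesis by (simp add: derivation_ext_def wedge.sum_right)
qed

text \<open>Expanding \<open>adjoint l\<close> in the basis and exchanging the sums moves
  \<open>l\<close> from the wedge factor into the contraction.\<close>

lemma derivation_ext_swap:
  assumes "linear l"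
  shows "derivation_ext (adjoint l) X = (\<Sum>\<nu>\<in>UNIV. mv_of_vec (bvec \<nu>) \<^bold>\<and> interior_prod (l (bvec \<nu>)) X)"
proof -
  have "derivation_ext (adjoint l) X = (\<Sum>\<mu>\<in>UNIV. \<Sum>\<nu>\<in>UNIV.
      (l (bvec \<nu>) $ \<mu>) *\<^sub>R (mv_of_vec (bvec \<nu>) \<^bold>\<and> interior_prod (bvec \<mu>) X))"
  proof -
    have "adjoint l (bvec \<mu>) $ \<nu> = l (bvec \<nu>) $ \<mu>" for \<mu> \<nu>
      using adjoint_clauses(1)[OF assms, of "bvec \<nu>" "bvec \<mu>"] by (simp add: inner_bvec)
    then have "mv_of_vec (adjoint l (bvec \<mu>)) = (\<Sum>\<nu>\<in>UNIV. (l (bvec \<nu>) $ \<mu>) *\<^sub>R mv_of_vec (bvec \<nu>))" for \<mu>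
      by (subst linear_bvec_expansion[OF linear_mv_of_vec]) simp
    then show ?thesis
      by (simp add: derivation_ext_def wedge.sum_left wedge.scaleR_left)
  qed
  also have "\<dots> = (\<Sum>\<nu>\<in>UNIV. \<Sum>\<mu>\<in>UNIV.
      (l (bvec \<nu>) $ \<mu>) *\<^sub>R (mv_of_vec (bvec \<nu>) \<^bold>\<and> interior_prod (bvec \<mu>) X))"
    by (rule sum.swap)
  also have "\<dots> = (\<Sum>\<nu>\<in>UNIV. mv_of_vec (bvec \<nu>) \<^bold>\<and> interior_prod (l (bvec \<nu>)) X)"
    by (simp add: linear_bvec_expansion[OF linear_interior_prod_left, of "l (bvec _)" X]
        wedge.sum_right wedge.scaleR_right)
  finally show ?thesis .
qed

text \<open>Wedge and contraction by the same vector are adjoint to each other, so the adjoint of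
  the sum for \<open>l\<close> is the form given by \<open>derivation_ext_swap\<close>.\<close>

lemma adjoint_derivation_ext:
  assumes "linear l"
  shows "adjoint (derivation_ext l) = derivation_ext (adjoint l)"
proof (rule adjoint_unique, intro allI)
  fix X Y
  show "derivation_ext l X \<bullet> Y = X \<bullet> derivation_ext (adjoint l) Y"
    unfolding derivation_ext_swap[OF assms] unfolding derivation_ext_def
    by (simp only: inner_sum_left inner_sum_right inner_interior_prod_right
        inner_interior_prod[symmetric])
qed

text \<open>The commutator of a contraction with a derivation is again a contraction; it is the
  source of the trace in the divergence.\<close>

lemma interior_prod_derivation_ext:
  assumes "linear l"
  shows "interior_prod v (derivation_ext l X) =
    interior_prod (adjoint l v) X + derivation_ext l (interior_prod v X)"
proof -
  have "interior_prod v (derivation_ext l X) =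
     (\<Sum>\<mu>\<in>UNIV. (adjoint l v $ \<mu>) *\<^sub>R interior_prod (bvec \<mu>) X) +
     (\<Sum>\<mu>\<in>UNIV. mv_of_vec (l (bvec \<mu>)) \<^bold>\<and> interior_prod (bvec \<mu>) (interior_prod v X))"
    by (simp add: derivation_ext_def linear_sum[OF linear_interior_prod] interior_prod_vec_wedge
        interior_prod_anticommute[of v "bvec _"] wedge.minus_right adjoint_clauses(2)[OF assms, symmetric]
        inner_bvec sum.distrib)
  then show ?thesis
    by (simp add: derivation_ext_def flip: linear_bvec_expansion[OF linear_interior_prod_left])
qed

section \<open>The Levi-Civita connection field\<close>

lemma vec_of_mv_of_vec: "vec_of_mv (mv_of_vec v) = v"
  by (simp add: vec_of_mv_def mv_of_vec_def blade_def axis_def vec_eq_iff if_distrib cong: if_cong)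

lemma linear_vec_of_mv: "linear vec_of_mv"
  by (rule linearI) (simp_all add: vec_of_mv_def vec_eq_iff)

lemma vec_wedge_one: "mv_of_vec v \<^bold>\<and> blade {} = mv_of_vec v"
  by (simp add: mv_of_vec_def wedge.sum_left wedge.scaleR_left blade_wedge_blade shuffle_sign_def)

lemma interior_prod_vec: "interior_prod v (mv_of_vec u) = (v \<bullet> u) *\<^sub>R blade {}"
  using interior_prod_vec_wedge[of v u "blade {}"]
  by (simp add: vec_wedge_one interior_prod_one wedge.zero_right)

lemma interior_prod_bivector:
  "interior_prod v (mv_of_vec u \<^bold>\<and> mv_of_vec w) = (v \<bullet> u) *\<^sub>R mv_of_vec w - (v \<bullet> w) *\<^sub>R mv_of_vec u"
  by (simp add: interior_prod_vec_wedge interior_prod_vec wedge.scaleR_right vec_wedge_one)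

lemma linear_metric_commutator:
  assumes "linear m"
  shows "linear (metric_commutator m B)"
  by (rule linearI) (simp_all add: metric_commutator_def linear_add[OF assms] linear_scale[OF assms]
      interior_prod_add_left interior_prod_scaleR_left linear_neg[OF linear_vec_of_mv]
      linear_add[OF linear_vec_of_mv] linear_diff[OF linear_vec_of_mv] linear_scale[OF linear_vec_of_mv])

text \<open>With \<open>D\<^sub>\<kappa> = b\<^sub>\<kappa> \<cdot> \<partial>\<^sub>o g\<close> this is the Koszul formula: the lowered coefficients of \<open>\<lambda>\<close> are the
  Christoffel symbols of the first kind.\<close>

lemma inner_levi_civita_bvec:
  fixes C :: "('m, 'n::{finite,linorder}) chart" and g :: "('m, 'n) endo_field"
  assumes g: "linear (g p)" "adjoint (g p) = g p" and inv: "\<And>v. g p (inv (g p) v) = v"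
  defines "D \<equiv> \<lambda>\<kappa> b. dir_deriv_endo C (bvec \<kappa>) g (\<lambda>_. b) p"
  shows "g p (levi_civita C g (bvec \<kappa>) p (bvec \<mu>)) \<bullet> bvec \<nu> =
    (D \<kappa> (bvec \<mu>) \<bullet> bvec \<nu> + D \<mu> (bvec \<nu>) \<bullet> bvec \<kappa> - D \<nu> (bvec \<mu>) \<bullet> bvec \<kappa>) / 2"
proof -
  define c where "c \<alpha> \<beta> = bvec \<kappa> \<bullet> (D \<alpha> (bvec \<beta>) - D \<beta> (bvec \<alpha>))" for \<alpha> \<beta>
  \<comment> \<open>The bivectors in \<open>omega0\<close> are built with the inverse metric, so
    contraction by \<open>g p (bvec \<mu>)\<close> yields Kronecker deltas.\<close>
  have gi: "g p (bvec \<mu>) \<bullet> inv (g p) (bvec \<alpha>) = (if \<mu> = \<alpha> then 1 else 0)" for \<alpha>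
  proof -
    have "g p (bvec \<mu>) \<bullet> inv (g p) (bvec \<alpha>) = bvec \<mu> \<bullet> g p (inv (g p) (bvec \<alpha>))"
      using adjoint_clauses(2)[OF g(1)] g(2) by metis
    then show ?thesis by (simp add: inv inner_bvec bvec_nth)
  qed
  have \<delta>: "(\<Sum>\<alpha>\<in>UNIV. \<Sum>\<beta>\<in>UNIV. c \<alpha> \<beta> * ((if i = \<alpha> then 1 else 0) * (if \<beta> = j then 1 else 0))) = c i j"
    for i j
    by (simp add: mult_delta_left mult_delta_right)
  \<comment> \<open>The minus signs of \<open>omega0\<close> and \<open>metric_commutator\<close>
    cancel.\<close>
  have "metric_commutator (g p) (omega0 C g (bvec \<kappa>) p) (bvec \<mu>) =
      (1/4) *\<^sub>R (\<Sum>\<alpha>\<in>UNIV. \<Sum>\<beta>\<in>UNIV. c \<alpha> \<beta> *\<^sub>R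
        ((if \<mu> = \<alpha> then 1 else 0) *\<^sub>R inv (g p) (bvec \<beta>) - (if \<mu> = \<beta> then 1 else 0) *\<^sub>R inv (g p) (bvec \<alpha>)))"
    unfolding metric_commutator_def omega0_def
    by (simp only: linear_scale[OF linear_interior_prod] linear_sum[OF linear_interior_prod]
        interior_prod_bivector gi flip: scaleR_minus_left c_def D_def)
      (simp add: linear_scale[OF linear_vec_of_mv] linear_sum[OF linear_vec_of_mv]
        linear_diff[OF linear_vec_of_mv] vec_of_mv_of_vec c_def D_def)
  then have eq: "g p (metric_commutator (g p) (omega0 C g (bvec \<kappa>) p) (bvec \<mu>)) =
      (1/4) *\<^sub>R (\<Sum>\<alpha>\<in>UNIV. \<Sum>\<beta>\<in>UNIV. c \<alpha> \<beta> *\<^sub>R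
        ((if \<mu> = \<alpha> then 1 else 0) *\<^sub>R bvec \<beta> - (if \<mu> = \<beta> then 1 else 0) *\<^sub>R bvec \<alpha>))"
    by (simp only: linear_scale[OF g(1)] linear_sum[OF g(1)] linear_diff[OF g(1)] inv)
  have "g p (metric_commutator (g p) (omega0 C g (bvec \<kappa>) p) (bvec \<mu>)) \<bullet> bvec \<nu> =
      (1/4) * (\<Sum>\<alpha>\<in>UNIV. \<Sum>\<beta>\<in>UNIV. c \<alpha> \<beta> *
        ((if \<mu> = \<alpha> then 1 else 0) * (if \<beta> = \<nu> then 1 else 0)
         - (if \<nu> = \<alpha> then 1 else 0) * (if \<beta> = \<mu> then 1 else 0)))"
    unfolding eq inner_scaleR_left inner_sum_left inner_diff_left
    by (intro arg_cong[where f = "(*) _"] sum.cong refl) (simp add: inner_bvec(1) bvec_nth eq_commute mult.commute)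
  also have "\<dots> = (1/4) * (c \<mu> \<nu> - c \<nu> \<mu>)"
    by (simp only: right_diff_distrib sum_subtractf \<delta>)
  \<comment> \<open>Antisymmetry of \<open>c\<close> doubles the coefficient and turns 1/4 into the
    1/2 of the Christoffel symbols.\<close>
  also have "\<dots> = (D \<mu> (bvec \<nu>) \<bullet> bvec \<kappa> - D \<nu> (bvec \<mu>) \<bullet> bvec \<kappa>) / 2"
    by (simp add: c_def inner_diff_right inner_commute[of "bvec \<kappa>"])
  finally show ?thesis
    by (simp add: levi_civita_def linear_add[OF g(1)] linear_scale[OF g(1)] inv inner_add_left
        D_def)
qed

text \<open>At a single point the derivatives of \<open>g\<close> enter only as symmetric linear
  maps \<open>D\<close>, which makes the properties of the connection linear algebra.
  \<open>D \<kappa>\<close> will be multiplication by the derivative of the matrix of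
  \<open>g\<close>.\<close>

context
  fixes C :: "('m, 'n::{finite,linorder}) chart" and g :: "('m, 'n) endo_field" and p :: 'm
    and D :: "'n \<Rightarrow> 'n canonical_space \<Rightarrow> 'n canonical_space"
  assumes g: "linear (g p)" "adjoint (g p) = g p" and inv: "\<And>v. g p (inv (g p) v) = v"
    and D: "\<And>\<kappa> b. dir_deriv_endo C (bvec \<kappa>) g (\<lambda>_. b) p = D \<kappa> b"
    and D_lin: "\<And>\<kappa>. linear (D \<kappa>)" and D_adj: "\<And>\<kappa>. adjoint (D \<kappa>) = D \<kappa>"
begin

lemma metric_deriv_symmetric: "D \<kappa> u \<bullet> v = D \<kappa> v \<bullet> u"
  using adjoint_clauses(2)[OF D_lin, of \<kappa> u v] D_adj[of \<kappa>] by (simp add: inner_commute)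

lemma metric_symmetric: "g p u \<bullet> v = g p v \<bullet> u"
  using adjoint_clauses(2)[OF g(1), of u v] g(2) by (simp add: inner_commute)

text \<open>By symmetry, pairing \<open>u - v\<close> with \<open>w\<close> is pairing its image
  under \<open>g p\<close> with \<open>inv (g p) w\<close>.\<close>

lemma metric_inj: "g p u = g p v \<Longrightarrow> u = v"
proof -
  assume eq: "g p u = g p v"
  have "(u - v) \<bullet> w = 0" for w
  proof -
    have "(u - v) \<bullet> w = g p (u - v) \<bullet> inv (g p) w"
      using metric_symmetric[of "u - v" "inv (g p) w"] by (simp add: inv inner_commute[of w])
    then show ?thesis by (simp add: linear_diff[OF g(1)] eq)
  qed
  from this[of "u - v"] show ?thesis by simp
qed

lemma linear_inv_metric: "linear (inv (g p))"
  by (rule linearI; rule metric_inj) (simp_all add: inv linear_add[OF g(1)] linear_scale[OF g(1)])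

lemma linear_levi_civita: "linear (levi_civita C g (bvec \<kappa>) p)"
  by (rule linearI)
    (simp_all add: levi_civita_def D linear_add[OF D_lin] linear_scale[OF D_lin]
      linear_add[OF linear_inv_metric] linear_scale[OF linear_inv_metric]
      linear_add[OF linear_metric_commutator[OF g(1)]] linear_scale[OF linear_metric_commutator[OF g(1)]]
      algebra_simps)

text \<open>Exchanging \<kappa> and \<mu> in the Koszul formula exchanges its first two terms and
  fixes the third, by symmetry of each \<open>D\<close>.\<close>

lemma levi_civita_torsion_free:
  "levi_civita C g (bvec \<kappa>) p (bvec \<mu>) = levi_civita C g (bvec \<mu>) p (bvec \<kappa>)"
proof (rule metric_inj)
  have "g p (levi_civita C g (bvec \<kappa>) p (bvec \<mu>)) \<bullet> bvec \<nu> =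
      g p (levi_civita C g (bvec \<mu>) p (bvec \<kappa>)) \<bullet> bvec \<nu>" for \<nu>
    unfolding inner_levi_civita_bvec[where g = g and p = p, OF g inv] D
    using metric_deriv_symmetric[of \<mu> "bvec \<nu>" "bvec \<kappa>"] metric_deriv_symmetric[of \<kappa> "bvec \<mu>" "bvec \<nu>"]
      metric_deriv_symmetric[of \<nu> "bvec \<kappa>" "bvec \<mu>"] by simp
  then show "g p (levi_civita C g (bvec \<kappa>) p (bvec \<mu>)) = g p (levi_civita C g (bvec \<mu>) p (bvec \<kappa>))"
    by (simp add: vec_eq_iff inner_bvec)
qed

text \<open>Pairing with a basis vector adds two Koszul expressions with \<mu> and \<nu> exchanged:
  their last two terms cancel and the halves of the first add up.\<close>

lemma levi_civita_metric_compatible: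
  "D \<kappa> v = adjoint (levi_civita C g (bvec \<kappa>) p) (g p v) + g p (levi_civita C g (bvec \<kappa>) p v)"
proof (rule linear_ext_bvec[of "D \<kappa>"])
  let ?l = "levi_civita C g (bvec \<kappa>) p"
  show "linear (\<lambda>v. adjoint ?l (g p v) + g p (?l v))"
    using linear_compose_add[OF linear_compose[OF g(1) adjoint_linear[OF linear_levi_civita]]
        linear_compose[OF linear_levi_civita g(1)]] by (simp add: comp_def)
  fix \<mu>
  have "(adjoint ?l (g p (bvec \<mu>)) + g p (?l (bvec \<mu>))) \<bullet> bvec \<nu> = D \<kappa> (bvec \<mu>) \<bullet> bvec \<nu>" for \<nu>
  proof -
    have "adjoint ?l (g p (bvec \<mu>)) \<bullet> bvec \<nu> = g p (?l (bvec \<nu>)) \<bullet> bvec \<mu>"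
      by (simp add: adjoint_clauses(2)[OF linear_levi_civita] metric_symmetric)
    then show ?thesis
      unfolding inner_add_left
      using metric_deriv_symmetric[of \<kappa> "bvec \<mu>" "bvec \<nu>"]
      by (simp add: inner_levi_civita_bvec[where g = g and p = p, OF g inv] D field_simps)
  qed
  then show "D \<kappa> (bvec \<mu>) = adjoint ?l (g p (bvec \<mu>)) + g p (?l (bvec \<mu>))"
    by (simp add: vec_eq_iff inner_bvec)
qed (rule D_lin)

end

section \<open>Contractions over a torsion-free family of endomorphisms\<close>

lemma sum_symmetric_antisymmetric:
  fixes F :: "'n::finite \<Rightarrow> 'n \<Rightarrow> 'b::real_vector"
  assumes "\<And>\<mu> \<nu>. F \<mu> \<nu> = - F \<nu> \<mu>"
  shows "(\<Sum>\<mu>\<in>UNIV. \<Sum>\<nu>\<in>UNIV. F \<mu> \<nu>) = 0"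
proof -
  have "(\<Sum>\<mu>\<in>UNIV. \<Sum>\<nu>\<in>UNIV. F \<mu> \<nu>) = (\<Sum>\<mu>\<in>UNIV. \<Sum>\<nu>\<in>UNIV. - F \<nu> \<mu>)"
    using assms by (intro sum.cong refl) blast
  also have "\<dots> = - (\<Sum>\<nu>\<in>UNIV. \<Sum>\<mu>\<in>UNIV. F \<nu> \<mu>)"
    by (subst sum.swap) (simp add: sum_negf)
  finally have "2 *\<^sub>R (\<Sum>\<mu>\<in>UNIV. \<Sum>\<nu>\<in>UNIV. F \<mu> \<nu>) = 0"
    by (simp add: scaleR_2 eq_neg_iff_add_eq_0)
  then show ?thesis by simp
qed

lemma sum_bvec_wedge_derivation_ext:
  assumes lin: "\<And>\<mu>. linear (l \<mu>)" and sym: "\<And>\<mu> \<nu>. l \<mu> (bvec \<nu>) = l \<nu> (bvec \<mu>)"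
  shows "(\<Sum>\<mu>\<in>UNIV. mv_of_vec (bvec \<mu>) \<^bold>\<and> derivation_ext (adjoint (l \<mu>)) X) = 0"
  unfolding derivation_ext_swap[OF lin] wedge.sum_right
proof (rule sum_symmetric_antisymmetric)
  fix \<mu> \<nu>
  show "mv_of_vec (bvec \<mu>) \<^bold>\<and> (mv_of_vec (bvec \<nu>) \<^bold>\<and> interior_prod (l \<mu> (bvec \<nu>)) X) =
      - (mv_of_vec (bvec \<nu>) \<^bold>\<and> (mv_of_vec (bvec \<mu>) \<^bold>\<and> interior_prod (l \<nu> (bvec \<mu>)) X))"
    using vec_wedge_swap[of "bvec \<mu>" "bvec \<nu>"] sym[of \<mu> \<nu>] by simp
qed

text \<open>Once each contraction is moved past its derivation, the double contractions cancel by
  symmetry of \<open>l\<close> and only the commutator terms remain.\<close>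

lemma sum_interior_prod_derivation_ext:
  assumes lin: "\<And>\<mu>. linear (l \<mu>)" and sym: "\<And>\<mu> \<nu>. l \<mu> (bvec \<nu>) = l \<nu> (bvec \<mu>)"
  shows "(\<Sum>\<mu>\<in>UNIV. interior_prod (bvec \<mu>) (derivation_ext (l \<mu>) X)) =
    (\<Sum>\<nu>\<in>UNIV. trace (matrix (l \<nu>)) *\<^sub>R interior_prod (bvec \<nu>) X)"
proof -
  have "(\<Sum>\<mu>\<in>UNIV. derivation_ext (l \<mu>) (interior_prod (bvec \<mu>) X)) = 0"
    unfolding derivation_ext_def
  proof (rule sum_symmetric_antisymmetric)
    fix \<mu> \<nu>
    show "mv_of_vec (l \<mu> (bvec \<nu>)) \<^bold>\<and> interior_prod (bvec \<nu>) (interior_prod (bvec \<mu>) X) =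
        - (mv_of_vec (l \<nu> (bvec \<mu>)) \<^bold>\<and> interior_prod (bvec \<mu>) (interior_prod (bvec \<nu>) X))"
      using interior_prod_anticommute[of "bvec \<nu>" "bvec \<mu>" X] sym[of \<mu> \<nu>]
      by (simp add: wedge.minus_right)
  qed
  then have "(\<Sum>\<mu>\<in>UNIV. interior_prod (bvec \<mu>) (derivation_ext (l \<mu>) X)) =
      (\<Sum>\<mu>\<in>UNIV. interior_prod (adjoint (l \<mu>) (bvec \<mu>)) X)"
    by (simp add: interior_prod_derivation_ext[OF lin] sum.distrib)
  also have "\<dots> = (\<Sum>\<mu>\<in>UNIV. \<Sum>\<nu>\<in>UNIV. (l \<mu> (bvec \<nu>) $ \<mu>) *\<^sub>R interior_prod (bvec \<nu>) X)"
  proof (intro sum.cong refl)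
    fix \<mu>
    have "adjoint (l \<mu>) (bvec \<mu>) $ \<nu> = l \<mu> (bvec \<nu>) $ \<mu>" for \<nu>
      using adjoint_clauses(1)[OF lin, of "bvec \<nu>" \<mu> "bvec \<mu>"] by (simp add: inner_bvec)
    then show "interior_prod (adjoint (l \<mu>) (bvec \<mu>)) X =
        (\<Sum>\<nu>\<in>UNIV. (l \<mu> (bvec \<nu>) $ \<mu>) *\<^sub>R interior_prod (bvec \<nu>) X)"
      by (simp add: linear_bvec_expansion[OF linear_interior_prod_left, of "adjoint (l \<mu>) (bvec \<mu>)"])
  qed
  \<comment> \<open>The summation index labels the endomorphism; symmetry moves it into the
    argument, where the sum becomes the trace of the single map \<open>l \<nu>\<close>.\<close>
  also have "\<dots> = (\<Sum>\<nu>\<in>UNIV. \<Sum>\<mu>\<in>UNIV. (l \<nu> (bvec \<mu>) $ \<mu>) *\<^sub>R interior_prod (bvec \<nu>) X)"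
    by (subst sum.swap) (intro sum.cong refl, subst sym, rule refl)
  also have "\<dots> = (\<Sum>\<nu>\<in>UNIV. trace (matrix (l \<nu>)) *\<^sub>R interior_prod (bvec \<nu>) X)"
    by (simp add: trace_def matrix_def scaleR_sum_left flip: bvec_def)
  finally show ?thesis .
qed

section \<open>Derivatives of determinants and of extended endomorphisms\<close>

lemma has_vector_derivative_eventually_cong:
  assumes "eventually (\<lambda>t. f t = g t) (nhds x)"
  shows "(f has_vector_derivative d) (at x) \<longleftrightarrow> (g has_vector_derivative d) (at x)"
  by (rule has_vector_derivative_cong_ev)
    (use assms eventually_nhds_x_imp_x[OF assms] in simp_all)

lemma differentiable_eventually_cong:
  fixes f g :: "real \<Rightarrow> 'a::real_normed_vector"
  assumes "eventually (\<lambda>t. f t = g t) (nhds x)"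
  shows "f differentiable (at x) \<longleftrightarrow> g differentiable (at x)"
  using has_vector_derivative_eventually_cong[OF assms]
  by (meson differentiableI_vector vector_derivative_works)

lemma has_vector_derivative_entry:
  fixes A :: "real \<Rightarrow> real ^ 'n ^ 'm"
  assumes "(A has_vector_derivative A') F"
  shows "((\<lambda>t. A t $ i $ j) has_vector_derivative A' $ i $ j) F"
  by (intro bounded_linear.has_vector_derivative[OF bounded_linear_vec_nth] assms)

lemma has_vector_derivative_matrix_vector_mult:
  fixes A :: "real \<Rightarrow> real ^ 'n ^ 'm"
  assumes "(A has_vector_derivative A') F"
  shows "((\<lambda>t. A t *v v) has_vector_derivative A' *v v) F"
proof -
  have "bounded_linear (\<lambda>A :: real ^ 'n ^ 'm. A *v v)"
    by (intro linear_conv_bounded_linear[THEN iffD1] linearI)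
      (simp_all add: matrix_vector_mult_add_rdistrib scaleR_matrix_vector_assoc)
  from bounded_linear.has_vector_derivative[OF this assms] show ?thesis .
qed

text \<open>Product rule for the permutation expansion, grouped by the row that is
  differentiated.\<close>

lemma det_has_real_derivative:
  fixes A :: "real \<Rightarrow> real ^ 'n::finite ^ 'n"
  assumes "\<And>i j. ((\<lambda>t. A t $ i $ j) has_real_derivative A' $ i $ j) (at x)"
  shows "((\<lambda>t. det (A t)) has_real_derivative
    (\<Sum>i\<in>UNIV. det (\<chi> k. if k = i then A' $ i else A x $ k))) (at x)"
proof -
  let ?P = "{p. p permutes (UNIV :: 'n set)}"
  have "((\<lambda>t. det (A t)) has_real_derivative
     (\<Sum>p\<in>?P. of_int (sign p) * (\<Sum>i\<in>UNIV. A' $ i $ p i * (\<Prod>k\<in>UNIV - {i}. A x $ k $ p k)))) (at x)"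
    unfolding det_def
    by (intro DERIV_sum DERIV_cmult has_field_derivative_prod assms)
  also have "(\<Sum>p\<in>?P. of_int (sign p) * (\<Sum>i\<in>UNIV. A' $ i $ p i * (\<Prod>k\<in>UNIV - {i}. A x $ k $ p k))) =
    (\<Sum>i\<in>UNIV. \<Sum>p\<in>?P. of_int (sign p) * (A' $ i $ p i * (\<Prod>k\<in>UNIV - {i}. A x $ k $ p k)))"
    unfolding sum_distrib_left by (rule sum.swap)
  also have "\<dots> = (\<Sum>i\<in>UNIV. det (\<chi> k. if k = i then A' $ i else A x $ k))"
    unfolding det_def
  proof (intro sum.cong refl arg_cong2[where f = "(*)"])
    fix i :: 'n and p
    have "(\<Prod>k\<in>UNIV. (\<chi> k. if k = i then A' $ i else A x $ k) $ k $ p k) =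
      A' $ i $ p i * (\<Prod>k\<in>UNIV - {i}. (\<chi> k. if k = i then A' $ i else A x $ k) $ k $ p k)"
      by (subst prod.remove[of UNIV i]) simp_all
    then show "A' $ i $ p i * (\<Prod>k\<in>UNIV - {i}. A x $ k $ p k) =
        (\<Prod>k\<in>UNIV. (\<chi> k. if k = i then A' $ i else A x $ k) $ k $ p k)"
      by simp
  qed
  finally show ?thesis .
qed

text \<open>Row i of \<open>L ** A\<close> combines the rows of \<open>A\<close>; every contribution
  except that of row i repeats a row and has determinant zero.\<close>

lemma det_replace_row_mult:
  fixes A L :: "'a::comm_ring_1 ^ 'n::finite ^ 'n"
  shows "det (\<chi> k. if k = i then (L ** A) $ i else A $ k) = L $ i $ i * det A"
proof -
  have row: "(L ** A) $ i = (\<Sum>j\<in>UNIV. L $ i $ j *s A $ j)"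
    by (simp add: vec_eq_iff matrix_matrix_mult_def)
  have "det (\<chi> k. if k = i then (L ** A) $ i else A $ k) =
      (\<Sum>j\<in>UNIV. L $ i $ j * det (\<chi> k. if k = i then A $ j else A $ k))"
    unfolding row by (simp add: det_linear_row_sum det_row_mul)
  also have "\<dots> = (\<Sum>j\<in>UNIV. if j = i then L $ i $ i * det A else 0)"
  proof (intro sum.cong refl)
    fix j
    have "(\<chi> k. if k = i then A $ i else A $ k) = A"
      by (simp add: vec_eq_iff)
    moreover have "det (\<chi> k. if k = i then A $ j else A $ k) = 0" if "j \<noteq> i"
      using that by (intro det_identical_rows[of i j]) (auto simp: row_def)
    ultimately show "L $ i $ j * det (\<chi> k. if k = i then A $ j else A $ k) =
        (if j = i then L $ i $ i * det A else 0)"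
      by auto
  qed
  finally show ?thesis by simp
qed

text \<open>Jacobi's formula; writing the derivative as \<open>L ** A x\<close> takes the place of
  an adjugate.\<close>

lemma det_has_real_derivative_trace:
  fixes A :: "real \<Rightarrow> real ^ 'n::finite ^ 'n"
  assumes "(A has_vector_derivative L ** A x) (at x)"
  shows "((\<lambda>t. det (A t)) has_real_derivative trace L * det (A x)) (at x)"
  using det_has_real_derivative[of A "L ** A x" x] has_vector_derivative_entry[OF assms]
  by (simp add: has_real_derivative_iff_has_vector_derivative det_replace_row_mult trace_def sum_distrib_right)

text \<open>Cramer's rule makes each coordinate of the solution a quotient of determinants with
  differentiable entries. It serves for the columns of \<open>inv h \<circ> \<eta>\<close>, whose
  differentiability is not given.\<close>

lemma matrix_solution_differentiable:
  fixes A :: "real \<Rightarrow> real ^ 'n::finite ^ 'n" and u v :: "real \<Rightarrow> real ^ 'n"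
  assumes A: "\<And>i j. (\<lambda>t. A t $ i $ j) differentiable (at x)" and v: "\<And>i. (\<lambda>t. v t $ i) differentiable (at x)"
    and "det (A x) \<noteq> 0" and ev: "eventually (\<lambda>t. det (A t) \<noteq> 0 \<and> A t *v u t = v t) (nhds x)"
  shows "(\<lambda>t. u t $ k) differentiable (at x)"
proof -
  have det_diff: "(\<lambda>t. det (B t)) differentiable (at x)"
    if "\<And>i j. (\<lambda>t. B t $ i $ j) differentiable (at x)" for B :: "real \<Rightarrow> real ^ 'n ^ 'n"
  proof -
    from that have "\<exists>d. ((\<lambda>t. B t $ i $ j) has_real_derivative d) (at x)" for i j
      by (simp add: real_differentiable_def)
    then obtain d where "\<And>i j. ((\<lambda>t. B t $ i $ j) has_real_derivative d i j) (at x)"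
      by metis
    then have "((\<lambda>t. B t $ i $ j) has_real_derivative (\<chi> i j. d i j) $ i $ j) (at x)" for i j
      by simp
    from det_has_real_derivative[OF this] show ?thesis
      by (auto simp: real_differentiable_def)
  qed
  let ?B = "\<lambda>t. \<chi> i j. if j = k then v t $ i else A t $ i $ j"
  have "(\<lambda>t. det (?B t) / det (A t)) differentiable (at x)"
  proof (intro differentiable_divide det_diff A assms(3))
    show "(\<lambda>t. ?B t $ i $ j) differentiable (at x)" for i j
      by (cases "j = k") (simp_all add: A v)
  qed
  moreover have "eventually (\<lambda>t. det (?B t) / det (A t) = u t $ k) (nhds x)"
    using ev
  proof eventually_elim
    case (elim t)
    then have "u t = (\<chi> k. det (\<chi> i j. if j = k then v t $ i else A t $ i $ j) / det (A t))"
      using cramer[of "A t" "u t" "v t"] by simp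
    then show ?case by (simp only: vec_lambda_beta)
  qed
  ultimately show ?thesis
    using differentiable_eventually_cong[of "\<lambda>t. det (?B t) / det (A t)" "\<lambda>t. u t $ k"] by blast
qed

section \<open>Derivatives of extended endomorphisms\<close>

lemma has_vector_derivative_mv_of_vec:
  assumes "\<And>i. ((\<lambda>t. v t $ i) has_vector_derivative v' $ i) F"
  shows "((\<lambda>t. mv_of_vec (v t)) has_vector_derivative mv_of_vec v') F"
  unfolding mv_of_vec_def
  by (intro has_vector_derivative_sum bounded_linear.has_vector_derivative[OF bounded_linear_scaleR_left] assms)

text \<open>Only the images of blades depend on the endomorphism; \<open>\<delta>\<close> collects
  their derivatives, and the product rule for coefficient times image gives the two terms.\<close>

lemma has_vector_derivative_ext_map:
  fixes X :: "real \<Rightarrow> 'n::{finite,linorder} multivector"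
  assumes "\<And>S. ((\<lambda>t. ext_map (T t) (blade S)) has_vector_derivative \<delta> (blade S)) (at x)"
    and "linear \<delta>" and X: "(X has_vector_derivative X') (at x)"
  shows "((\<lambda>t. ext_map (T t) (X t)) has_vector_derivative \<delta> (X x) + ext_map (T x) X') (at x)"
proof -
  have expand: "l Y = (\<Sum>S\<in>UNIV. (Y $ S) *\<^sub>R l (blade S))" if "linear l"
    for l :: "'n multivector \<Rightarrow> 'n multivector" and Y
    by (subst blade_expansion[of Y, symmetric]) (simp add: linear_sum[OF that] linear_scale[OF that])
  have "((\<lambda>t. \<Sum>S\<in>UNIV. (X t $ S) *\<^sub>R ext_map (T t) (blade S)) has_vector_derivative
      (\<Sum>S\<in>UNIV. (X x $ S) *\<^sub>R \<delta> (blade S) + (X' $ S) *\<^sub>R ext_map (T x) (blade S))) (at x)"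
    by (intro has_vector_derivative_sum bounded_bilinear.has_vector_derivative[OF bounded_bilinear_scaleR]
        bounded_linear.has_vector_derivative[OF bounded_linear_vec_nth] assms)
  then show ?thesis
    by (simp add: sum.distrib flip: expand[OF linear_ext_map] expand[OF \<open>linear \<delta>\<close>])
qed

lemma ext_map_differentiable:
  fixes X :: "real \<Rightarrow> 'n::{finite,linorder} multivector"
  assumes T: "\<And>i j. (\<lambda>t. T t (bvec i) $ j) differentiable (at x)" and X: "(X has_vector_derivative X') (at x)"
  shows "\<exists>E. ((\<lambda>t. ext_map (T t) (X t)) has_vector_derivative E) (at x)"
proof -
  from T have "\<exists>d. ((\<lambda>t. T t (bvec i) $ j) has_real_derivative d) (at x)" for i j
    by (simp add: real_differentiable_def)
  then obtain d where d: "\<And>i j. ((\<lambda>t. T t (bvec i) $ j) has_real_derivative d i j) (at x)"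
    by metis
  have mv: "((\<lambda>t. mv_of_vec (T t (bvec i))) has_vector_derivative mv_of_vec (\<chi> j. d i j)) (at x)" for i
    by (rule has_vector_derivative_mv_of_vec)
      (use d in \<open>simp add: has_real_derivative_iff_has_vector_derivative\<close>)
  have "\<exists>E. ((\<lambda>t. foldr (\<lambda>i Y. mv_of_vec (T t (bvec i)) \<^bold>\<and> Y) xs (blade {})) has_vector_derivative E) (at x)"
    for xs
  proof (induction xs)
    case (Cons i xs)
    then obtain E where "((\<lambda>t. foldr (\<lambda>i Y. mv_of_vec (T t (bvec i)) \<^bold>\<and> Y) xs (blade {})) has_vector_derivative E) (at x)"
      by blast
    from wedge.has_vector_derivative[OF mv[of i] this] show ?case by auto
  qed (auto intro: has_vector_derivative_const)
  then have "\<exists>E. ((\<lambda>t. ext_map (T t) (blade S)) has_vector_derivative E) (at x)" for S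
    unfolding ext_map_blade .
  then obtain E where E: "\<And>S. ((\<lambda>t. ext_map (T t) (blade S)) has_vector_derivative E S) (at x)"
    by metis
  define \<delta> where "\<delta> Y = (\<Sum>S\<in>UNIV. (Y $ S) *\<^sub>R E S)" for Y :: "'n multivector"
  have "\<delta> (blade S) = (\<Sum>R\<in>UNIV. if R = S then E S else 0)" for S
    unfolding \<delta>_def by (intro sum.cong) (auto simp: blade_def axis_def)
  then have "\<delta> (blade S) = E S" for S by simp
  moreover have "linear \<delta>"
    by (rule linearI) (simp_all add: \<delta>_def scaleR_add_left sum.distrib scaleR_sum_right)
  ultimately show ?thesis
    using has_vector_derivative_ext_map[of T \<delta> x X X'] E X by auto
qed

text \<open>The product rule for an iterated wedge is the recursion assumed of
  \<open>\<delta>\<close>, so induction over the factors of a blade identifies the derivative. A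
  candidate for \<open>\<delta>\<close> can thus be checked algebraically.\<close>

lemma has_vector_derivative_ext_map_Leibniz:
  fixes X :: "real \<Rightarrow> 'n::{finite,linorder} multivector"
  assumes T: "\<And>i j. ((\<lambda>t. T t (bvec i) $ j) has_vector_derivative T' (bvec i) $ j) (at x)"
    and lin: "linear (T x)" "linear \<delta>" and one: "\<delta> (blade {}) = 0"
    and Leibniz: "\<And>v Y. \<delta> (mv_of_vec v \<^bold>\<and> Y) = mv_of_vec (T' v) \<^bold>\<and> ext_map (T x) Y + mv_of_vec (T x v) \<^bold>\<and> \<delta> Y"
    and X: "(X has_vector_derivative X') (at x)"
  shows "((\<lambda>t. ext_map (T t) (X t)) has_vector_derivative \<delta> (X x) + ext_map (T x) X') (at x)"
proof (rule has_vector_derivative_ext_map[OF _ lin(2) X])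
  have mv: "((\<lambda>t. mv_of_vec (T t (bvec i))) has_vector_derivative mv_of_vec (T' (bvec i))) (at x)" for i
    by (rule has_vector_derivative_mv_of_vec) (rule T)
  have ext: "ext_map (T x) (foldr (\<lambda>i Y. mv_of_vec (bvec i) \<^bold>\<and> Y) xs (blade {})) =
      foldr (\<lambda>i Y. mv_of_vec (T x (bvec i)) \<^bold>\<and> Y) xs (blade {})" for xs
    by (induction xs) (simp_all add: ext_map_one ext_map_vec_wedge lin)
  have "((\<lambda>t. foldr (\<lambda>i Y. mv_of_vec (T t (bvec i)) \<^bold>\<and> Y) xs (blade {})) has_vector_derivative
     \<delta> (foldr (\<lambda>i Y. mv_of_vec (bvec i) \<^bold>\<and> Y) xs (blade {}))) (at x)" for xs
  proof (induction xs)
    case (Cons i xs)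
    from wedge.has_vector_derivative[OF mv[of i] this] show ?case
      by (simp add: Leibniz ext add.commute)
  qed (simp add: one)
  from this[of "sorted_list_of_set _"]
  show "((\<lambda>t. ext_map (T t) (blade S)) has_vector_derivative \<delta> (blade S)) (at x)" for S
    unfolding ext_map_blade blade_sorted_list .
qed

text \<open>The derivations extending \<open>k\<close> and \<open>l\<close> satisfy the required
  Leibniz rule, so the form k T + T l of the derivative lifts from vectors to multivectors. Metric
  compatibility is the case where \<open>k\<close> is the adjoint of \<open>l\<close>.\<close>

lemma has_vector_derivative_ext_map_derivation:
  fixes X :: "real \<Rightarrow> 'n::{finite,linorder} multivector"
  assumes T: "\<And>i j. ((\<lambda>t. T t (bvec i) $ j) has_vector_derivative T' (bvec i) $ j) (at x)"
    and lin: "linear (T x)" "linear k" "linear l" and T': "\<And>v. T' v = k (T x v) + T x (l v)"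
    and X: "(X has_vector_derivative X') (at x)"
  shows "((\<lambda>t. ext_map (T t) (X t)) has_vector_derivative
    derivation_ext k (ext_map (T x) (X x)) + ext_map (T x) (derivation_ext l (X x)) + ext_map (T x) X') (at x)"
proof (rule has_vector_derivative_ext_map_Leibniz[OF T lin(1) _ _ _ X, where
      \<delta> = "\<lambda>X. derivation_ext k (ext_map (T x) X) + ext_map (T x) (derivation_ext l X)"])
  show "linear (\<lambda>X. derivation_ext k (ext_map (T x) X) + ext_map (T x) (derivation_ext l X))"
    using linear_compose_add[OF linear_compose[OF linear_ext_map linear_derivation_ext]
        linear_compose[OF linear_derivation_ext linear_ext_map]] by (simp add: comp_def)
qed (simp_all add: ext_map_one derivation_ext_one linear_0[OF linear_ext_map] ext_map_vec_wedge lin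
    derivation_ext_vec_wedge linear_add[OF linear_ext_map] T' linear_add[OF linear_mv_of_vec]
    wedge.add_left wedge.add_right)

section \<open>Gauge metric fields\<close>

lemma matrix_add_rdistrib: "(A + B) ** C = A ** C + B ** (C :: 'a::semiring_1 ^ 'n ^ 'm)"
  by (simp add: vec_eq_iff matrix_matrix_mult_def distrib_right sum.distrib)

lemma matrix_nth: "matrix f $ i $ j = f (bvec j) $ i"
  by (simp add: matrix_def bvec_def)

lemma adjoint_bvec_nth: "linear f \<Longrightarrow> adjoint f (bvec i) $ j = f (bvec j) $ i"
  using adjoint_clauses(1)[of f "bvec j" "bvec i"] by (simp add: inner_bvec)

lemma bij_of_endo_det: "linear f \<Longrightarrow> endo_det f \<noteq> 0 \<Longrightarrow> bij f"
  by (simp add: endo_det_def det_nz_iff_inj bij_def linear_injective_imp_surjective)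

lemma linear_inv_of_bij:
  fixes f :: "'a::real_vector \<Rightarrow> 'b::real_vector"
  assumes "linear f" "bij f"
  shows "linear (inv f)"
proof -
  have "f (inv f v) = v" for v
    using assms(2) by (simp add: bij_is_surj surj_f_inv_f)
  then show ?thesis
    by (intro linearI; intro injD[OF bij_is_inj[OF assms(2)]])
      (simp_all add: linear_add[OF assms(1)] linear_scale[OF assms(1)])
qed

text \<open>The algebra of a gauge metric at one point, kept apart from smoothness so that it
  applies at every point of a curve.\<close>

locale gauge_endo =
  fixes h \<eta> g :: "'n::{finite,linorder} canonical_space \<Rightarrow> 'n canonical_space"
  assumes linear_h: "linear h" and det_h: "endo_det h \<noteq> 0"
    and linear_\<eta>: "linear \<eta>" and det_\<eta>: "endo_det \<eta> \<noteq> 0" and \<eta>_inv: "\<eta> = inv \<eta>"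
    and \<eta>_adjoint: "adjoint \<eta> = \<eta>"
    and g_eq: "g = adjoint h \<circ> \<eta> \<circ> h"
begin

lemma bij_h: "bij h" by (rule bij_of_endo_det[OF linear_h det_h])

lemma h_inv [simp]: "h (inv h v) = v" "inv h (h v) = v"
  using bij_h by (simp_all add: bij_is_surj surj_f_inv_f bij_is_inj)

lemma \<eta>_\<eta> [simp]: "\<eta> (\<eta> v) = v"
  by (subst (1) \<eta>_inv) (simp add: bij_is_inj[OF bij_of_endo_det[OF linear_\<eta> det_\<eta>]])

lemma linear_inv_h: "linear (inv h)" by (rule linear_inv_of_bij[OF linear_h bij_h])

lemma linear_star: "linear (star_map h)"
  unfolding star_map_def by (rule adjoint_linear[OF linear_inv_h])

lemma linear_g: "linear g"
  unfolding g_eq by (intro linear_compose linear_h linear_\<eta> adjoint_linear)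

lemma adjoint_g: "adjoint g = g"
proof (rule adjoint_unique, intro allI)
  fix x y
  have "adjoint h (\<eta> (h x)) \<bullet> y = x \<bullet> adjoint h (\<eta> (h y))"
    by (metis adjoint_clauses linear_h linear_\<eta> \<eta>_adjoint)
  then show "g x \<bullet> y = x \<bullet> g y" by (simp add: g_eq)
qed

lemma star_adjoint: "star_map h (adjoint h v) = v"
proof (rule vector_eq_ldot[THEN iffD1, rule_format])
  fix w
  have "w \<bullet> star_map h (adjoint h v) = h (inv h w) \<bullet> v"
    unfolding star_map_def using adjoint_clauses(1)[OF linear_inv_h] adjoint_clauses(1)[OF linear_h] by metis
  then show "w \<bullet> star_map h (adjoint h v) = w \<bullet> v" by simp
qed

lemma adjoint_star: "adjoint h (star_map h v) = v"
proof (rule vector_eq_ldot[THEN iffD1, rule_format])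
  fix w
  have "w \<bullet> adjoint h (star_map h v) = inv h (h w) \<bullet> v"
    unfolding star_map_def using adjoint_clauses(1)[OF linear_inv_h] adjoint_clauses(1)[OF linear_h] by metis
  then show "w \<bullet> adjoint h (star_map h v) = w \<bullet> v" by simp
qed

lemma star_comp_g: "star_map h \<circ> g = \<eta> \<circ> h"
  by (simp add: g_eq fun_eq_iff star_adjoint)

text \<open>In \<open>adjoint h \<circ> \<eta> \<circ> h \<circ> inv h \<circ> \<eta>\<close> the
  inner factors cancel because \<open>\<eta>\<close> is an involution.\<close>

lemma ext_map_g_inverse: "ext_map g (ext_map (inv h \<circ> \<eta>) Y) = ext_map (adjoint h) Y"
proof -
  have "g \<circ> (inv h \<circ> \<eta>) = adjoint h"
    by (simp add: g_eq fun_eq_iff)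
  then show ?thesis
    using ext_map_comp[OF linear_g linear_compose[OF linear_\<eta> linear_inv_h], of Y] by simp
qed

text \<open>The vector on the left is what contraction by \<open>\<eta> (star_map h v)\<close>
  becomes after passing through the extensions of \<open>star_map h\<close> and \<open>g\<close>;
  the adjoint of \<open>star_map h\<close> is \<open>inv h\<close>, and the factors of
  \<open>g\<close> undo the others one by one.\<close>

lemma g_gauge: "g (adjoint (star_map h) (\<eta> (star_map h v))) = v"
  by (simp add: star_map_def adjoint_adjoint[OF linear_inv_h] g_eq)
    (simp add: adjoint_star[unfolded star_map_def])

lemma det_g: "(det (matrix g))\<^sup>2 = (det (matrix h)) ^ 4"
proof -
  have "matrix g = transpose (matrix h) ** matrix \<eta> ** matrix h"
    unfolding g_eq
    by (simp add: matrix_compose linear_compose linear_h linear_\<eta> adjoint_linear matrix_adjoint comp_assoc matrix_mul_assoc)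
  then have g: "det (matrix g) = det (matrix h) * det (matrix \<eta>) * det (matrix h)"
    by (simp add: det_mul det_transpose)
  have "\<eta> \<circ> \<eta> = id" by (simp add: fun_eq_iff)
  then have "matrix \<eta> ** matrix \<eta> = mat 1"
    using matrix_compose[OF linear_\<eta> linear_\<eta>] by (simp add: matrix_id_mat_1)
  then have "det (matrix \<eta>) * det (matrix \<eta>) = 1"
    by (metis det_mul det_I)
  then show ?thesis
    unfolding g by (simp add: power2_eq_square power4_eq_xxxx mult.assoc mult.left_commute)
qed

text \<open>Moving the contraction inward makes it Euclidean contraction by \<open>v\<close>; the
  two extensions left outside compose to the outer factor of the divergence formula.\<close>

lemma metric_interior_prod_gauge:
  "metric_interior_prod \<eta> (star_map h v) (ext_map (star_map h) (ext_map g Q)) =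
    ext_map (\<eta> \<circ> h) (interior_prod v Q)"
proof -
  have "metric_interior_prod \<eta> (star_map h v) (ext_map (star_map h) (ext_map g Q)) =
      ext_map (star_map h) (ext_map g (interior_prod v Q))"
    by (simp add: metric_interior_prod_def interior_prod_ext_map linear_star linear_g adjoint_g g_gauge)
  then show ?thesis
    by (simp add: ext_map_comp[OF linear_star linear_g, symmetric] star_comp_g)
qed

end

text \<open>One coordinate direction of the divergence, for an abstract \<open>l\<close> compatible
  with the derivative of \<open>g\<close>. The same W' in both conclusions is the link between the
  weighted field and the covariant derivative.\<close>

lemma gauge_curve:
  fixes h \<eta> g :: "real \<Rightarrow> 'n::{finite,linorder} canonical_space \<Rightarrow> 'n canonical_space"
  assumes H: "((\<lambda>t. matrix (h t)) has_vector_derivative H') (at x)"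
    and N: "((\<lambda>t. matrix (\<eta> t)) has_vector_derivative N') (at x)"
    and G: "((\<lambda>t. matrix (g t)) has_vector_derivative G') (at x)"
    and X: "(X has_vector_derivative X') (at x)"
    and ev: "eventually (\<lambda>t. gauge_endo (h t) (\<eta> t) (g t)) (nhds x)"
    and l: "linear l" and compat: "\<And>v. G' *v v = adjoint l (g x v) + g x (l v)"
  obtains Y' W' where
    "((\<lambda>t. ext_map (adjoint (h t)) (X t)) has_vector_derivative Y') (at x)"
    "((\<lambda>t. endo_det (h t) *\<^sub>R ext_map (inv (h t) \<circ> \<eta> t) (X t)) has_vector_derivative
       endo_det (h x) *\<^sub>R (W' + trace (matrix l) *\<^sub>R ext_map (inv (h x) \<circ> \<eta> x) (X x))) (at x)"
    "Y' - derivation_ext (adjoint l) (ext_map (adjoint (h x)) (X x)) =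
       ext_map (g x) (W' + derivation_ext l (ext_map (inv (h x) \<circ> \<eta> x) (X x)))"
proof -
  define W where "W t = ext_map (inv (h t) \<circ> \<eta> t) (X t)" for t
  interpret gauge_endo "h x" "\<eta> x" "g x"
    using eventually_nhds_x_imp_x[OF ev] .
  have entry: "(\<lambda>t. matrix (f t) $ i $ j) differentiable (at x)"
    if "((\<lambda>t. matrix (f t)) has_vector_derivative f') (at x)"
    for f :: "real \<Rightarrow> 'n canonical_space \<Rightarrow> 'n canonical_space" and f' i j
    using has_vector_derivative_entry[OF that] by (rule differentiableI_vector)
  \<comment> \<open>Column i solves a linear system with the matrix of \<open>h t\<close> and
    right-hand side \<open>\<eta> t (bvec i)\<close>.\<close>
  have "(\<lambda>t. (inv (h t) \<circ> \<eta> t) (bvec i) $ j) differentiable (at x)" for i j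
  proof (rule matrix_solution_differentiable)
    show "(\<lambda>t. matrix (h t) $ i $ j) differentiable (at x)" for i j
      by (rule entry[OF H])
    show "(\<lambda>t. \<eta> t (bvec i) $ j) differentiable (at x)" for j
      using entry[OF N, of j i] by (simp add: matrix_nth)
    show "det (matrix (h x)) \<noteq> 0"
      using det_h by (simp add: endo_det_def)
    show "eventually (\<lambda>t. det (matrix (h t)) \<noteq> 0 \<and>
        matrix (h t) *v (inv (h t) \<circ> \<eta> t) (bvec i) = \<eta> t (bvec i)) (nhds x)"
      using ev
    proof eventually_elim
      case (elim t)
      then interpret t: gauge_endo "h t" "\<eta> t" "g t" .
      show ?case
        using t.det_h by (simp add: endo_det_def matrix_works t.linear_h)
    qed
  qed
  then obtain W' where W': "(W has_vector_derivative W') (at x)"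
    unfolding W_def using ext_map_differentiable[of "\<lambda>t. inv (h t) \<circ> \<eta> t", OF _ X] by blast
  \<comment> \<open>Product rule for g(W), with compatibility in place of the derivative of
    \<open>g\<close>.\<close>
  define Y' where "Y' = derivation_ext (adjoint l) (ext_map (g x) (W x)) +
     ext_map (g x) (derivation_ext l (W x)) + ext_map (g x) W'"
  have "((\<lambda>t. ext_map (g t) (W t)) has_vector_derivative Y') (at x)"
    unfolding Y'_def
  proof (rule has_vector_derivative_ext_map_derivation[where T = g and x = x and T' = "(*v) G'",
        OF _ linear_g adjoint_linear[OF l] l _ W'])
    show "((\<lambda>t. g t (bvec i) $ j) has_vector_derivative (G' *v bvec i) $ j) (at x)" for i j
      using has_vector_derivative_entry[OF G, of j i]
      by (simp add: matrix_nth bvec_def matrix_vector_mult_basis column_def)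
  qed (rule compat)
  moreover have YW: "eventually (\<lambda>t. ext_map (g t) (W t) = ext_map (adjoint (h t)) (X t)) (nhds x)"
    using ev by (rule eventually_mono) (simp add: W_def gauge_endo.ext_map_g_inverse)
  ultimately have Y: "((\<lambda>t. ext_map (adjoint (h t)) (X t)) has_vector_derivative Y') (at x)"
    by (simp add: has_vector_derivative_eventually_cong)
  have "Y' - derivation_ext (adjoint l) (ext_map (adjoint (h x)) (X x)) =
       ext_map (g x) (W' + derivation_ext l (W x))"
    using eventually_nhds_x_imp_x[OF YW] by (simp add: Y'_def linear_add[OF linear_ext_map])
  moreover have "((\<lambda>t. endo_det (h t) *\<^sub>R W t) has_vector_derivative
       endo_det (h x) *\<^sub>R (W' + trace (matrix l) *\<^sub>R W x)) (at x)"
  proof -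
    let ?H = "\<lambda>t. det (matrix (h t))" and ?G = "\<lambda>t. det (matrix (g t))"
    have H0: "?H x \<noteq> 0" using det_h by (simp add: endo_det_def)
    then have G0: "?G x \<noteq> 0" using det_g by auto
    obtain d where d: "(?H has_real_derivative d) (at x)"
      using det_has_real_derivative[of "\<lambda>t. matrix (h t)" H' x] has_vector_derivative_entry[OF H]
      by (auto simp: has_real_derivative_iff_has_vector_derivative)
    let ?M = "matrix (g x)" and ?L = "matrix l"
    obtain Mi where Mi: "?M ** Mi = mat 1" "Mi ** ?M = mat 1"
      using G0 by (metis invertible_def invertible_det_nz)
    have G'_eq: "G' = transpose ?L ** ?M + ?M ** ?L"
    proof -
      have "G' *v v = (transpose ?L ** ?M + ?M ** ?L) *v v" for v
        using compat[of v]
        by (simp add: matrix_vector_mult_add_rdistrib matrix_works linear_g l adjoint_linear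
            flip: matrix_vector_mul_assoc matrix_adjoint[OF l])
      then show ?thesis by (simp add: matrix_eq)
    qed
    have "(G' ** Mi) ** ?M = G'"
      by (simp add: Mi flip: matrix_mul_assoc)
    then have "(?G has_real_derivative trace (G' ** Mi) * ?G x) (at x)"
      using det_has_real_derivative_trace[of "\<lambda>t. matrix (g t)" "G' ** Mi" x] G by simp
    \<comment> \<open>Transposition and conjugation preserve the trace, so both halves of
      compatibility contribute \<open>trace ?L\<close>.\<close>
    moreover have "trace (G' ** Mi) = 2 * trace ?L"
    proof -
      have "G' ** Mi = transpose ?L + ?M ** ?L ** Mi"
        by (simp add: G'_eq matrix_add_rdistrib Mi flip: matrix_mul_assoc)
      moreover have "trace (?M ** ?L ** Mi) = trace ?L"
        by (subst trace_mul_sym) (simp add: matrix_mul_assoc Mi)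
      moreover have "trace (transpose ?L) = trace ?L"
        by (simp add: trace_def transpose_def)
      ultimately show ?thesis by (simp add: trace_add)
    qed
    ultimately have dG: "((\<lambda>t. (?G t)\<^sup>2) has_real_derivative 2 * ?G x * (2 * trace ?L * ?G x)) (at x)"
      by (auto intro!: derivative_eq_intros)
    have "((\<lambda>t. ?H t ^ 4) has_real_derivative 4 * ?H x ^ 3 * d) (at x)"
      by (rule derivative_eq_intros d refl)+ simp
    moreover have "eventually (\<lambda>t. (?G t)\<^sup>2 = ?H t ^ 4) (nhds x)"
      using ev by (rule eventually_mono) (rule gauge_endo.det_g)
    ultimately have "((\<lambda>t. (?G t)\<^sup>2) has_real_derivative 4 * ?H x ^ 3 * d) (at x)"
      by (simp add: has_real_derivative_iff_has_vector_derivative has_vector_derivative_eventually_cong)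
    \<comment> \<open>Two derivatives of the same function; cancelling the nonzero
      \<open>4 * ?H x ^ 3\<close> will isolate \<open>d\<close>.\<close>
    then have "2 * ?G x * (2 * trace ?L * ?G x) = 4 * ?H x ^ 3 * d"
      by (rule DERIV_unique[OF dG])
    then have "4 * ?H x ^ 3 * d = 4 * trace ?L * (?G x)\<^sup>2"
      by (simp add: power2_eq_square mult_ac)
    also have "\<dots> = 4 * ?H x ^ 3 * (trace ?L * ?H x)"
      by (simp add: det_g power3_eq_cube power4_eq_xxxx)
    finally have "d = trace ?L * ?H x"
      using H0 by simp
    with bounded_bilinear.has_vector_derivative[OF bounded_bilinear_scaleR
        d[unfolded has_real_derivative_iff_has_vector_derivative] W']
    show ?thesis
      by (simp add: endo_det_def scaleR_add_right mult.commute)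
  qed
  ultimately show ?thesis
    using Y that unfolding W_def by blast
qed

section \<open>Coordinate lines in a chart\<close>

lemma chart_inv_eq:
  assumes "smooth_atlas \<A>" "C \<in> \<A>" "p \<in> fst C"
  shows "chart_inv C (snd C p) = p"
proof -
  have "homeomorphism (fst C) (snd C ` fst C) (snd C) (chart_inv C)"
    using assms by (auto simp: smooth_atlas_def)
  then show ?thesis
    using assms(3) by (simp add: homeomorphism_def)
qed

text \<open>The chart image of \<open>U\<close> is open, so a short segment of the line stays inside
  it; the fields are controlled on \<open>U\<close> only.\<close>

lemma chart_line_eventually_in:
  fixes C :: "('m::{t2_space,second_countable_topology}, 'n::finite) chart"
  assumes atlas: "smooth_atlas \<A>" "C \<in> \<A>" and U: "open U" "U \<subseteq> fst C" "p \<in> U"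
  shows "eventually (\<lambda>t. chart_inv C (snd C p + t *\<^sub>R v) \<in> U) (nhds (0::real))"
proof -
  have hom: "homeomorphism (fst C) (snd C ` fst C) (snd C) (chart_inv C)" and op: "open (snd C ` fst C)"
    using atlas by (auto simp: smooth_atlas_def)
  have "openin (top_of_set (snd C ` fst C)) (snd C ` U)"
    using homeomorphism_imp_open_map[OF hom] U by (simp add: open_subset)
  then have "open (snd C ` U)"
    using op openin_open_trans by blast
  moreover have "((\<lambda>t. snd C p + t *\<^sub>R v) \<longlongrightarrow> snd C p + 0 *\<^sub>R v) (nhds (0::real))"
    by (intro tendsto_intros filterlim_ident)
  ultimately have "eventually (\<lambda>t. snd C p + t *\<^sub>R v \<in> snd C ` U) (nhds (0::real))"
    using U(3) by (intro topological_tendstoD) auto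
  then show ?thesis
  proof eventually_elim
    case (elim t)
    then obtain q where "q \<in> U" "snd C p + t *\<^sub>R v = snd C q" by auto
    then show ?case using chart_inv_eq[OF atlas, of q] U(2) by auto
  qed
qed

lemma smooth_map_on_chart_line:
  fixes C :: "('m::{t2_space,second_countable_topology}, 'n::finite) chart"
  assumes "C \<in> \<A>" "U \<subseteq> fst C" "p \<in> U" "smooth_map_on \<A> U F"
  shows "((\<lambda>t. F (chart_inv C (snd C p + t *\<^sub>R bvec \<mu>))) has_vector_derivative partial_deriv C \<mu> F p) (at 0)"
proof -
  have "smooth_on (snd C ` (U \<inter> fst C)) (F \<circ> chart_inv C)"
    using assms(1,4) by (simp add: smooth_map_on_def)
  then have "Ck_on (Suc 0) (snd C ` (U \<inter> fst C)) (F \<circ> chart_inv C)"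
    unfolding smooth_on_def by blast
  then have "(F \<circ> chart_inv C) differentiable (at (snd C p))"
    using assms(2,3) by auto
  then have "(F \<circ> chart_inv C) differentiable (at (snd C p + 0 *\<^sub>R bvec \<mu>))" by simp
  moreover have "(\<lambda>t::real. snd C p + t *\<^sub>R bvec \<mu>) differentiable (at 0)"
    by (intro derivative_intros)
  ultimately have "(F \<circ> chart_inv C \<circ> (\<lambda>t. snd C p + t *\<^sub>R bvec \<mu>)) differentiable (at 0)"
    by (intro differentiable_chain_at) auto
  then show ?thesis
    unfolding partial_deriv_def by (simp add: vector_derivative_works comp_def)
qed

lemma partial_deriv_eqI:
  assumes "((\<lambda>t. F (chart_inv C (snd C p + t *\<^sub>R bvec \<mu>))) has_vector_derivative d) (at 0)"
  shows "partial_deriv C \<mu> F p = d"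
  unfolding partial_deriv_def by (rule vector_derivative_at[OF assms])

lemma dir_deriv_bvec: "dir_deriv C (bvec \<mu>) F p = partial_deriv C \<mu> F p"
proof -
  have "dir_deriv C (bvec \<mu>) F p = (\<Sum>\<nu>\<in>UNIV. if \<nu> = \<mu> then partial_deriv C \<mu> F p else 0)"
    unfolding dir_deriv_def by (intro sum.cong refl) (auto simp: inner_bvec bvec_nth)
  then show ?thesis by simp
qed

theorem mainTheorem13:
  fixes \<A> :: "('m::{t2_space,second_countable_topology}, 'n::{finite,linorder}) chart set"
    and U\<^sub>o U :: "'m set"
    and \<phi>\<^sub>o :: "'m \<Rightarrow> 'n canonical_space"
    and g \<eta> h :: "('m, 'n) endo_field"
    and X :: "'m \<Rightarrow> 'n multivector"
  assumes "smooth_atlas \<A>"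
    and "(U\<^sub>o, \<phi>\<^sub>o) \<in> \<A>"
    and "open U" and "U \<subseteq> U\<^sub>o"
    and "metric_field \<A> U g"
    and "gauge_metric_field \<A> U g \<eta> h"
    and "smooth_map_on \<A> U X"
  shows "\<forall>p\<in>U.
    gauge_div (U\<^sub>o, \<phi>\<^sub>o) g \<eta> h X p =
      (1 / endo_det (h p)) *\<^sub>R ext_map (\<eta> p \<circ> h p)
        (chart_div (U\<^sub>o, \<phi>\<^sub>o) (\<lambda>q. endo_det (h q) *\<^sub>R ext_map (inv (h q) \<circ> \<eta> q) (X q)) p) \<and>
    gauge_curl (U\<^sub>o, \<phi>\<^sub>o) g h X p =
      ext_map (star_map (h p))
        (chart_curl (U\<^sub>o, \<phi>\<^sub>o) (\<lambda>q. ext_map (adjoint (h q)) (X q)) p)"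
proof (intro ballI)
  fix p assume p: "p \<in> U"
  let ?C = "(U\<^sub>o, \<phi>\<^sub>o)"
  \<comment> \<open>The coordinate line through \<open>p\<close> in direction \<mu>, along which the
    partial derivatives are taken.\<close>
  define c where "c \<mu> t = chart_inv ?C (\<phi>\<^sub>o p + t *\<^sub>R bvec \<mu>)" for \<mu> and t :: real
  note atlas = assms(1,2) and U = assms(3,4)
  have c0: "c \<mu> 0 = p" for \<mu>
    using chart_inv_eq[OF atlas] p U(2) by (auto simp: c_def)
  have c_in: "eventually (\<lambda>t. c \<mu> t \<in> U) (nhds 0)" for \<mu>
    using chart_line_eventually_in[OF atlas U(1) _ p] U(2) by (simp add: c_def)
  have deriv: "((\<lambda>t. F (c \<mu> t)) has_vector_derivative partial_deriv ?C \<mu> F p) (at 0)"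
    if "smooth_map_on \<A> U F" for F :: "'m \<Rightarrow> 'b::real_normed_vector" and \<mu>
    using smooth_map_on_chart_line[OF atlas(2) _ p that] U(2) by (simp add: c_def)
  have partial: "partial_deriv ?C \<mu> F p = d" if "((\<lambda>t. F (c \<mu> t)) has_vector_derivative d) (at 0)"
    for F :: "'m \<Rightarrow> 'b::real_normed_vector" and \<mu> d
    using that by (intro partial_deriv_eqI) (simp add: c_def)

  have gauge: "gauge_endo (h q) (\<eta> q) (g q)" if "q \<in> U" for q
    using assms(6) that unfolding gauge_metric_field_def orthogonal_metric_field_def
      metric_field_def smooth_endo_field_def gauge_endo_def by metis
  interpret gauge_endo "h p" "\<eta> p" "g p" by (rule gauge[OF p])
  have smooth: "smooth_map_on \<A> U (\<lambda>q. matrix (g q))" "smooth_map_on \<A> U (\<lambda>q. matrix (\<eta> q))"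
      "smooth_map_on \<A> U (\<lambda>q. matrix (h q))"
    using assms(5,6)
    by (auto simp: gauge_metric_field_def orthogonal_metric_field_def metric_field_def smooth_endo_field_def)
  define G' where "G' \<mu> = partial_deriv ?C \<mu> (\<lambda>q. matrix (g q)) p" for \<mu>
  have G': "((\<lambda>t. matrix (g (c \<mu> t))) has_vector_derivative G' \<mu>) (at 0)" for \<mu>
    unfolding G'_def by (rule deriv[OF smooth(1)])
  have D: "dir_deriv_endo ?C (bvec \<mu>) g (\<lambda>_. b) p = G' \<mu> *v b" for \<mu> b
  proof -
    have "eventually (\<lambda>t. matrix (g (c \<mu> t)) *v b = g (c \<mu> t) b) (nhds 0)"
      using c_in[of \<mu>] by (rule eventually_mono) (simp add: matrix_works gauge_endo.linear_g[OF gauge])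
    then have "((\<lambda>t. g (c \<mu> t) b) has_vector_derivative G' \<mu> *v b) (at 0)"
      using has_vector_derivative_matrix_vector_mult[OF G', of \<mu> b]
      by (simp add: has_vector_derivative_eventually_cong)
    then have "partial_deriv ?C \<mu> (\<lambda>q. g q b) p = G' \<mu> *v b"
      by (rule partial)
    moreover have "partial_deriv ?C \<mu> (\<lambda>q. b) p = 0"
      by (rule partial) (rule has_vector_derivative_const)
    ultimately show ?thesis
      by (simp add: dir_deriv_endo_def dir_deriv_bvec linear_0[OF linear_g])
  qed
  \<comment> \<open>Symmetry of \<open>g\<close> along the line near \<open>p\<close> passes to the
    derivative because derivatives are unique.\<close>
  have G'_adj: "adjoint ((*v) (G' \<mu>)) = (*v) (G' \<mu>)" for \<mu>
  proof -
    have "G' \<mu> $ i $ j = G' \<mu> $ j $ i" for i j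
    proof -
      have "eventually (\<lambda>t. matrix (g (c \<mu> t)) $ i $ j = matrix (g (c \<mu> t)) $ j $ i) (nhds 0)"
        using c_in[of \<mu>]
      proof (rule eventually_mono)
        fix t assume "c \<mu> t \<in> U"
        then interpret t: gauge_endo "h (c \<mu> t)" "\<eta> (c \<mu> t)" "g (c \<mu> t)" by (rule gauge)
        show "matrix (g (c \<mu> t)) $ i $ j = matrix (g (c \<mu> t)) $ j $ i"
          using adjoint_bvec_nth[OF t.linear_g, of j i] by (simp add: matrix_nth t.adjoint_g)
      qed
      then have "((\<lambda>t. matrix (g (c \<mu> t)) $ i $ j) has_vector_derivative G' \<mu> $ j $ i) (at 0)"
        using has_vector_derivative_entry[OF G', of \<mu> j i] by (simp add: has_vector_derivative_eventually_cong)
      from vector_derivative_unique_at[OF has_vector_derivative_entry[OF G'] this] show ?thesis .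
    qed
    then have "transpose (G' \<mu>) = G' \<mu>"
      by (simp add: transpose_def vec_eq_iff)
    then show ?thesis using adjoint_matrix[of "G' \<mu>"] by simp
  qed
  have g_surj: "g p (inv (g p) v) = v" for v
    using bij_of_endo_det[OF linear_g] assms(5) p
    by (simp add: metric_field_def bij_is_surj surj_f_inv_f)
  define l where "l \<mu> = levi_civita ?C g (bvec \<mu>) p" for \<mu>
  note lc = linear_g adjoint_g g_surj D matrix_vector_mul_linear G'_adj
  have l: "linear (l \<mu>)" and l_sym: "l \<mu> (bvec \<nu>) = l \<nu> (bvec \<mu>)"
    and compat: "G' \<mu> *v v = adjoint (l \<mu>) (g p v) + g p (l \<mu> v)" for \<mu> \<nu> v
    unfolding l_def
    by (rule linear_levi_civita[of g p ?C "\<lambda>\<mu>. (*v) (G' \<mu>)", OF lc]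
        levi_civita_torsion_free[of g p ?C "\<lambda>\<mu>. (*v) (G' \<mu>)", OF lc]
        levi_civita_metric_compatible[of g p ?C "\<lambda>\<mu>. (*v) (G' \<mu>)", OF lc])+
  have ext_l: "levi_civita_ext ?C g (bvec \<mu>) p = derivation_ext (l \<mu>)" for \<mu>
    by (simp add: fun_eq_iff levi_civita_ext_def derivation_ext_def l_def)

  let ?Y = "\<lambda>q. ext_map (adjoint (h q)) (X q)" and ?W = "\<lambda>q. ext_map (inv (h q) \<circ> \<eta> q) (X q)"
  have "\<exists>W'. partial_deriv ?C \<mu> (\<lambda>q. endo_det (h q) *\<^sub>R ?W q) p =
        endo_det (h p) *\<^sub>R (W' + trace (matrix (l \<mu>)) *\<^sub>R ?W p) \<and>
      partial_deriv ?C \<mu> ?Y p - derivation_ext (adjoint (l \<mu>)) (?Y p) =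
        ext_map (g p) (W' + derivation_ext (l \<mu>) (?W p))" for \<mu>
  proof -
    have "eventually (\<lambda>t. gauge_endo (h (c \<mu> t)) (\<eta> (c \<mu> t)) (g (c \<mu> t))) (nhds 0)"
      using c_in[of \<mu>] by (rule eventually_mono) (rule gauge)
    from gauge_curve[OF deriv[OF smooth(3)] deriv[OF smooth(2)] G' deriv[OF assms(7)] this l, unfolded c0, OF compat]
    obtain Y' W' where Y': "((\<lambda>t. ?Y (c \<mu> t)) has_vector_derivative Y') (at 0)"
      and W': "((\<lambda>t. endo_det (h (c \<mu> t)) *\<^sub>R ?W (c \<mu> t)) has_vector_derivative
         endo_det (h p) *\<^sub>R (W' + trace (matrix (l \<mu>)) *\<^sub>R ?W p)) (at 0)"
      and eq: "Y' - derivation_ext (adjoint (l \<mu>)) (?Y p) = ext_map (g p) (W' + derivation_ext (l \<mu>) (?W p))"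
      .
    show ?thesis
      using partial[OF W'] eq unfolding partial[OF Y'] by blast
  qed
  then have "\<exists>W'. \<forall>\<mu>. partial_deriv ?C \<mu> (\<lambda>q. endo_det (h q) *\<^sub>R ?W q) p =
        endo_det (h p) *\<^sub>R (W' \<mu> + trace (matrix (l \<mu>)) *\<^sub>R ?W p) \<and>
      partial_deriv ?C \<mu> ?Y p - derivation_ext (adjoint (l \<mu>)) (?Y p) =
        ext_map (g p) (W' \<mu> + derivation_ext (l \<mu>) (?W p))"
    by (intro choice allI)
  then obtain W' where W':
    "\<And>\<mu>. partial_deriv ?C \<mu> (\<lambda>q. endo_det (h q) *\<^sub>R ?W q) p =
        endo_det (h p) *\<^sub>R (W' \<mu> + trace (matrix (l \<mu>)) *\<^sub>R ?W p)"
    "\<And>\<mu>. partial_deriv ?C \<mu> ?Y p - derivation_ext (adjoint (l \<mu>)) (?Y p) =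
        ext_map (g p) (W' \<mu> + derivation_ext (l \<mu>) (?W p))"
    by blast
  have cov: "gauge_cov_deriv_minus ?C g h (bvec \<mu>) X p =
      ext_map (star_map (h p)) (partial_deriv ?C \<mu> ?Y p - derivation_ext (adjoint (l \<mu>)) (?Y p))" for \<mu>
    by (simp add: gauge_cov_deriv_minus_def cov_deriv_minus_def dir_deriv_bvec ext_l adjoint_derivation_ext l)

  \<comment> \<open>\<open>star_map (h p)\<close> is pulled out of wedge and sum; the connection
    part left inside vanishes by torsion-freeness.\<close>
  have "gauge_curl ?C g h X p = ext_map (star_map (h p)) (chart_curl ?C ?Y p)"
    by (simp add: gauge_curl_def chart_curl_def cov linear_sum[OF linear_ext_map]
        sum_bvec_wedge_derivation_ext[OF l l_sym] wedge.diff_right sum_subtractf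
        flip: ext_map_vec_wedge[OF linear_star] linear_sum[OF linear_ext_map])
  moreover have "gauge_div ?C g \<eta> h X p = (1 / endo_det (h p)) *\<^sub>R ext_map (\<eta> p \<circ> h p)
        (chart_div ?C (\<lambda>q. endo_det (h q) *\<^sub>R ?W q) p)"
  proof -
    have "gauge_div ?C g \<eta> h X p = ext_map (\<eta> p \<circ> h p)
        (\<Sum>\<mu>\<in>UNIV. interior_prod (bvec \<mu>) (W' \<mu> + derivation_ext (l \<mu>) (?W p)))"
      by (simp add: gauge_div_def cov W'(2) metric_interior_prod_gauge linear_sum[OF linear_ext_map])
    \<comment> \<open>The trace produced by contracting the connection is the one by which the
      derivative of \<open>endo_det (h q)\<close> enters the weighted field.\<close>
    also have "(\<Sum>\<mu>\<in>UNIV. interior_prod (bvec \<mu>) (W' \<mu> + derivation_ext (l \<mu>) (?W p))) =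
        (\<Sum>\<mu>\<in>UNIV. interior_prod (bvec \<mu>) (W' \<mu> + trace (matrix (l \<mu>)) *\<^sub>R ?W p))"
      by (simp add: linear_add[OF linear_interior_prod] linear_scale[OF linear_interior_prod] sum.distrib
          sum_interior_prod_derivation_ext[OF l l_sym])
    also have "\<dots> = (1 / endo_det (h p)) *\<^sub>R chart_div ?C (\<lambda>q. endo_det (h q) *\<^sub>R ?W q) p"
      using det_h by (simp add: chart_div_def W'(1) linear_scale[OF linear_interior_prod]
          flip: scaleR_sum_right)
    finally show ?thesis unfolding linear_scale[OF linear_ext_map] .
  qed
  ultimately show "gauge_div ?C g \<eta> h X p = (1 / endo_det (h p)) *\<^sub>R ext_map (\<eta> p \<circ> h p)
        (chart_div ?C (\<lambda>q. endo_det (h q) *\<^sub>R ?W q) p) \<and>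
      gauge_curl ?C g h X p = ext_map (star_map (h p)) (chart_curl ?C ?Y p)"
    by blast
qed

end
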